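(* Let $\mathbb K$ be a field of characteristic $0$, let $(\mathbf C,\otimes,I,\gamma)$ be a symmetric strict monoidal $\mathrm{Ch}^{[-1,0]}_{\mathbb K}$-category and let $t:\otimes\Rightarrow\otimes$ be a totally symmetric strict infinitesimal 2-braiding on it. Then the data (with trivial pentagonator) $$\Big(\mathbf C_{\mathbb K[h]/(h^3)},\ \otimes,\ I,\ \alpha:=1+\tfrac{h^2}{24}[t_{12},t_{23}],\ \sigma:=\gamma e^{\frac h2t},\ \mathcal H^L:=\tfrac{h^2}{24}\gamma_{1(23)}\mathsf h^L,\ \mathcal H^R:=\tfrac{h^2}{24}\gamma_{(12)3}\mathsf h^R\Big)$$ satisfies the left tetrahedron axiom, the right tetrahedron axiom and the hexahedron axiom.
   Context: **Enriched setting.** Let $R$ be a commutative $\mathbb K$-algebra (used for $R=\mathbb K$ and $R=\mathbb K[h]/(h^3)$). $\mathrm{Ch}^{[-1,0]}_R$ denotes cochain complexes of $R$-modules concentrated in degrees $-1,0$, with the truncated tensor product (products of two degree $-1$ elements vanish and $(\partial\phi)\otimes\phi'=\phi\otimes\partial\phi'$ for degree $-1$ elements). Thus a $\mathrm{Ch}^{[-1,0]}_R$-category $\mathbf C$ has $R$-modules $\mathbf C[U,V]^0$ (1-cells) and $\mathbf C[U,V]^{-1}$ (2-cells, or homotopies), $R$-linear maps $\partial:\mathbf C[U,V]^{-1}\to\mathbf C[U,V]^0$, and an $R$-bilinear associative unital degree-preserving composition (juxtaposition) in which composites of two 2-cells vanish, $\partial(f\phi)=f\,\partial\phi$, $\partial(\phi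 f)=(\partial\phi)f$ and $(\partial\phi)\phi'=\phi\,\partial\phi'$ for 1-cells $f$ and 2-cells $\phi,\phi'$. $\mathbf C\boxtimes\mathbf D$ has pairs $UV$ as objects, truncated tensor products as hom complexes, and $(f'\boxtimes g')(f\boxtimes g)=f'f\boxtimes g'g$. $\mathbf C_{\mathbb K[h]/(h^3)}$ has the same objects as $\mathbf C$, with homs tensored with $\mathbb K[h]/(h^3)$ and all structure extended linearly. **Pseudonatural transformations.** For $\mathrm{Ch}^{[-1,0]}_R$-functors $F,G:\mathbf C\to\mathbf D$, a pseudonatural transformation $\xi:F\Rightarrow G$ consists of 1-cells $\xi_U\in\mathbf D[F(U),G(U)]^0$ and $R$-linear maps $f\mapsto\xi_f$, $\mathbf C[U,U']^0\to\mathbf D[F(U),G(U')]^{-1}$, with $G(f)\xi_U-\xi_{U'}F(f)=\partial\xi_f$ for 1-cells $f$, $G(q)\xi_U-\xi_{U'}F(q)=\xi_{\partial q}$ for 2-cells $q$, $\xi_{1_U}=0$, and $\xi_{f'f}=\xi_{f'}F(f)+G(f')\xi_f$. It is $\mathrm{Ch}^{[-1,0]}_R$-natural if all $\xi_f=0$. Vertical composition: $(\theta\xi)_U=\theta_U\xi_U$, $(\theta\xi)_f=\theta_f\xi_U+\theta_{U'}\xi_f$; the identity $1$ has $1_f=0$; sums and scalar multiples are componentwise; $[\xi,\theta]=\xi\theta-\theta\xi$. If all $\xi_U$ are invertible, $\xi$ has inverse $(\xi^{-1})_U=(\xi_U)^{-1}$, $(\xi^{-1})_f=-(\xi_{U'})^{-1}\xi_f(\xi_U)^{-1}$.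 **Symmetric strict monoidal categories.** $(\mathbf C,\otimes,I,\gamma)$ consists of a $\mathrm{Ch}^{[-1,0]}_R$-category, a strictly associative and strictly unital $\mathrm{Ch}^{[-1,0]}_R$-functor $\otimes:\mathbf C\boxtimes\mathbf C\to\mathbf C$ (on objects $(UV)$; brackets in subscripts only record the grouping of arguments), and a $\mathrm{Ch}^{[-1,0]}_R$-natural isomorphism $\gamma_{UV}:(UV)\to(VU)$ with $\gamma_{VU}\gamma_{UV}=1_{(UV)}$ and $\gamma_{U(VW)}=(1_V\otimes\gamma_{UW})(\gamma_{UV}\otimes1_W)$. **Infinitesimal 2-braidings.** An infinitesimal 2-braiding is a pseudonatural transformation $t:\otimes\Rightarrow\otimes$, with components $t_{UV}$ and $t_{f\boxtimes g}\in\mathbf C[(UV),(U'V')]^{-1}$ for $f:U\to U'$, $g:V\to V'$. It is strict if for all objects $U,V,W$ and 1-cells $f:U\to U'$, $g:V\to V'$, $k:W\to W'$: $t_{U(VW)}=t_{UV}\otimes1_W+(\gamma_{VU}\otimes1_W)(1_V\otimes t_{UW})(\gamma_{UV}\otimes1_W)$, $t_{f\boxtimes(g\otimes k)}=t_{f\boxtimes g}\otimes k+(\gamma_{V'U'}\otimes1_{W'})(g\otimes t_{f\boxtimes k})(\gamma_{UV}\otimes1_W)$, $t_{(UV)W}=1_U\otimes t_{VW}+(1_U\otimes\gamma_{WV})(t_{UW}\otimes1_V)(1_U\otimes\gamma_{VW})$, $t_{(f\otimes g)\boxtimes k}=f\otimes t_{g\boxtimes k}+(1_{U'}\otimes\gamma_{W'V'})(t_{f\boxtimes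 k}\otimes g)(1_U\otimes\gamma_{VW})$. It is symmetric if $\gamma_{UV}t_{UV}=t_{VU}\gamma_{UV}$ and $\gamma_{U'V'}t_{f\boxtimes g}=t_{g\boxtimes f}\gamma_{UV}$; it is totally symmetric if it is symmetric and $t_{\gamma_{UV}\boxtimes1_W}=0$ for all $U,V,W$. **The data.** $t_{12},t_{23}$ are the pseudonatural endomorphisms of $\otimes^2:\mathbf C^{\boxtimes3}\to\mathbf C$ with components $(t_{12})_{UVW}=t_{UV}\otimes1_W$, $(t_{12})_{f\boxtimes g\boxtimes k}=t_{f\boxtimes g}\otimes k$, $(t_{23})_{UVW}=1_U\otimes t_{VW}$, $(t_{23})_{f\boxtimes g\boxtimes k}=f\otimes t_{g\boxtimes k}$. $\gamma e^{\frac h2t}=\gamma(1+\frac h2t+\frac{h^2}8t^2)$ modulo $h^3$. The four-term relationators have components $\mathcal L_{UVW}=t_{t_{UV}\boxtimes1_W}$ and $\mathcal R_{UVW}=t_{1_U\boxtimes t_{VW}}$, and $\mathsf h^L=2\mathcal L+\mathcal R$, $\mathsf h^R=\mathcal L+2\mathcal R$. Hence $\mathcal H^L_{UVW}=\frac{h^2}{24}\gamma_{U(VW)}(2\mathcal L_{UVW}+\mathcal R_{UVW})$ and $\mathcal H^R_{UVW}=\frac{h^2}{24}\gamma_{(UV)W}(\mathcal L_{UVW}+2\mathcal R_{UVW})$. Subscripts such as $\alpha_{f\boxtimes g\boxtimes k}$, $\sigma_{f\boxtimes g}$ denote homotopy components; $1_{UV}$ inside such a subscript means $1_U\boxtimes1_V$.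 **Axioms (trivial pentagonator), for all objects $U,V,W,X$.** *Left tetrahedron:* $(1_V\otimes\alpha_{WXU})\alpha_{V(WX)U}\sigma_{1_U\boxtimes\alpha_{VWX}}\alpha_{U(VW)X}(\alpha_{UVW}\otimes1_X)+(1_V\otimes\alpha_{WXU})\mathcal H^L_{UV(WX)}\alpha_{(UV)WX}+(1_V\otimes\alpha_{WXU}\sigma_{U(WX)})\alpha_{VU(WX)}\alpha_{\sigma_{UV}\boxtimes1_W\boxtimes1_X}$ $=\alpha_{VW(XU)}\mathcal H^L_{U(VW)X}(\alpha_{UVW}\otimes1_X)-\alpha_{1_V\boxtimes1_W\boxtimes\sigma_{UX}}\alpha_{(VW)UX}(\sigma_{U(VW)}\alpha_{UVW}\otimes1_X)+\big(1_V\otimes(1_W\otimes\sigma_{UX})\alpha_{WUX}\big)\alpha_{V(WU)X}(\mathcal H^L_{UVW}\otimes1_X)-(1_V\otimes\mathcal H^L_{UWX})\alpha_{V(UW)X}\big(\alpha_{VUW}(\sigma_{UV}\otimes1_W)\otimes1_X\big)-\big(1_V\otimes(1_W\otimes\sigma_{UX})\alpha_{WUX}\big)\alpha_{1_V\boxtimes\sigma_{UW}\boxtimes1_X}\big(\alpha_{VUW}(\sigma_{UV}\otimes1_W)\otimes1_X\big)$. *Right tetrahedron:* $(\alpha^{-1}_{XUV}\otimes1_W)\alpha^{-1}_{X(UV)W}\sigma_{\alpha^{-1}_{UVW}\boxtimes1_X}\alpha^{-1}_{U(VW)X}(1_U\otimes\alpha^{-1}_{VWX})+(\alpha^{-1}_{XUV}\otimes1_W)\mathcal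 H^R_{(UV)WX}\alpha^{-1}_{UV(WX)}+(\alpha^{-1}_{XUV}\sigma_{(UV)X}\otimes1_W)\alpha^{-1}_{(UV)XW}\alpha^{-1}_{1_{UV}\boxtimes\sigma_{WX}}$ $=\alpha^{-1}_{(XU)VW}\mathcal H^R_{U(VW)X}(1_U\otimes\alpha^{-1}_{VWX})-\big((\sigma_{UX}\otimes1_V)\alpha^{-1}_{UXV}\otimes1_W\big)\alpha^{-1}_{1_U\boxtimes\sigma_{VX}\boxtimes1_W}\big(1_U\otimes\alpha^{-1}_{VXW}(1_V\otimes\sigma_{WX})\big)-\alpha^{-1}_{\sigma_{UX}\boxtimes1_{VW}}\alpha^{-1}_{UX(VW)}\big(1_U\otimes\sigma_{(VW)X}\alpha^{-1}_{VWX}\big)+\big((\sigma_{UX}\otimes1_V)\alpha^{-1}_{UXV}\otimes1_W\big)\alpha^{-1}_{U(XV)W}(1_U\otimes\mathcal H^R_{VWX})-(\mathcal H^R_{UVX}\otimes1_W)\alpha^{-1}_{U(VX)W}\big(1_U\otimes\alpha^{-1}_{VXW}(1_V\otimes\sigma_{WX})\big)$. *Hexahedron:* $\alpha_{W(XU)V}(\alpha_{WXU}\otimes1_V)\mathcal H^R_{UV(WX)}(1_U\otimes\alpha_{VWX})\alpha_{U(VW)X}-(1_W\otimes\alpha^{-1}_{XUV})\mathcal H^L_{(UV)WX}(\alpha^{-1}_{UVW}\otimes1_X)$ $=(1_W\otimes\mathcal H^R_{UVX})\alpha_{WU(VX)}\alpha_{(WU)VX}(\alpha^{-1}_{WUV}\sigma_{(UV)W}\alpha^{-1}_{UVW}\otimes1_X)$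 $+[1_W\otimes(\sigma_{UX}\otimes1_V)\alpha^{-1}_{UXV}(1_U\otimes\sigma_{VX})]\alpha_{WU(VX)}\big[\alpha_{(WU)VX}(\mathcal H^R_{UVW}\otimes1_X)-\alpha_{\sigma_{UW}\boxtimes1_{VX}}(\alpha^{-1}_{UWV}(1_U\otimes\sigma_{VW})\otimes1_X)\big]$ $+(1_W\otimes[\sigma_{UX}\otimes1_V]\alpha^{-1}_{UXV})\alpha_{1_{WU}\boxtimes\sigma_{VX}}(\sigma_{UW}\otimes1_{(VX)})\alpha_{(UW)VX}(\alpha^{-1}_{UWV}[1_U\otimes\sigma_{VW}]\otimes1_X)$ $+\alpha_{1_W\boxtimes\sigma_{UX}\boxtimes1_V}(\alpha_{WUX}\otimes1_V)\alpha^{-1}_{(WU)XV}[\sigma_{UW}\otimes\sigma_{VX}]\alpha_{(UW)VX}[\alpha^{-1}_{UWV}[1_U\otimes\sigma_{VW}]\otimes1_X]$ $-\alpha_{W(XU)V}[(1_W\otimes\sigma_{UX})\alpha_{WUX}\otimes1_V]\alpha^{-1}_{(WU)XV}(\sigma_{UW}\otimes\sigma_{VX})\alpha^{-1}_{UW(VX)}(1_U\otimes\alpha_{WVX})\alpha_{1_U\boxtimes\sigma_{VW}\boxtimes1_X}$ $-\alpha_{W(XU)V}[(1_W\otimes\sigma_{UX})\alpha_{WUX}\otimes1_V]\alpha^{-1}_{\sigma_{UW}\boxtimes1_{XV}}(1_{(UW)}\otimes\sigma_{VX})\alpha^{-1}_{UW(VX)}[1_U\otimes\alpha_{WVX}(\sigma_{VW}\otimes1_X)]\alpha_{U(VW)X}$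 $+\alpha_{W(XU)V}[(1_W\otimes\sigma_{UX})\alpha_{WUX}(\sigma_{UW}\otimes1_X)\otimes1_V]\alpha^{-1}_{(UW)XV}\alpha^{-1}_{1_{UW}\boxtimes\sigma_{VX}}[1_U\otimes\alpha_{WVX}(\sigma_{VW}\otimes1_X)]\alpha_{U(VW)X}$ $-\alpha_{W(XU)V}(\mathcal H^L_{UWX}\otimes1_V)\alpha^{-1}_{(UW)XV}\alpha^{-1}_{UW(XV)}[1_U\otimes(1_W\otimes\sigma_{VX})\alpha_{WVX}(\sigma_{VW}\otimes1_X)]\alpha_{U(VW)X}$ $-\alpha_{W(XU)V}(\alpha_{WXU}\sigma_{U(WX)}\alpha_{UWX}\otimes1_V)\alpha^{-1}_{(UW)XV}\alpha^{-1}_{UW(XV)}(1_U\otimes\mathcal H^L_{VWX})\alpha_{U(VW)X}$. *)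

theory Defs
  imports Complex_Main
begin

section \<open>The base ring K[h]/(h^3) and base change of modules\<close>

text \<open>
  \<open>Tr a b c\<close> stands for a + b h + c h^2. With coefficients in the field K this is the ring
  K[h]/(h^3); with coefficients in a K-module M it is the tensor product of M with K[h]/(h^3),
  which is free over K on 1, h, h^2.
\<close>

datatype 'a trunc = Tr (co0: 'a) (co1: 'a) (co2: 'a)

text \<open>The extension of a bilinear map, given by multiplication of truncated polynomials.\<close>

definition ext2 :: "('a \<Rightarrow> 'b \<Rightarrow> 'c::plus) \<Rightarrow> 'a trunc \<Rightarrow> 'b trunc \<Rightarrow> 'c trunc" where
  "ext2 b x y = Tr (b (co0 x) (co0 y))
                   (b (co0 x) (co1 y) + b (co1 x) (co0 y))
                   (b (co0 x) (co2 y) + b (co1 x) (co1 y) + b (co2 x) (co0 y))"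

definition cst :: "'a::zero \<Rightarrow> 'a trunc" where
  "cst a = Tr a 0 0"

instantiation trunc :: (ab_group_add) ab_group_add
begin
definition "0 = Tr 0 0 0"
definition "x + y = Tr (co0 x + co0 y) (co1 x + co1 y) (co2 x + co2 y)"
definition "- x = Tr (- co0 x) (- co1 x) (- co2 x)"
definition "x - y = Tr (co0 x - co0 y) (co1 x - co1 y) (co2 x - co2 y)"
instance
  by standard
    (auto simp: zero_trunc_def plus_trunc_def uminus_trunc_def minus_trunc_def algebra_simps)
end

instantiation trunc :: (comm_ring_1) comm_ring_1
begin
definition "1 = (cst 1 :: 'a trunc)"
definition "x * y = ext2 (*) x (y :: 'a trunc)"
instance
  by standard
    (auto simp: zero_trunc_def plus_trunc_def one_trunc_def cst_def times_trunc_def ext2_def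
      algebra_simps)
end

definition hh :: "'a::comm_ring_1 trunc" where
  "hh = Tr 0 1 0"

lemma hh_cube: "hh ^ 3 = 0"
  by (simp add: hh_def ext2_def times_trunc_def zero_trunc_def power3_eq_cube)


section \<open>Categories enriched in complexes concentrated in degrees -1 and 0\<close>

definition linear_map_on ::
    "('r \<Rightarrow> 'a \<Rightarrow> 'a) \<Rightarrow> ('r \<Rightarrow> 'b \<Rightarrow> 'b) \<Rightarrow> 'a::plus set \<Rightarrow> ('a \<Rightarrow> 'b::plus) \<Rightarrow> bool" where
  "linear_map_on s s' S f \<longleftrightarrow>
     (\<forall>x\<in>S. \<forall>y\<in>S. f (x + y) = f x + f y) \<and> (\<forall>c. \<forall>x\<in>S. f (s c x) = s' c (f x))"

definition bilinear_map_on ::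
    "('r \<Rightarrow> 'a \<Rightarrow> 'a) \<Rightarrow> ('r \<Rightarrow> 'b \<Rightarrow> 'b) \<Rightarrow> 'a::plus set \<Rightarrow> 'a set \<Rightarrow> ('a \<Rightarrow> 'a \<Rightarrow> 'b::plus) \<Rightarrow> bool"
    where
  "bilinear_map_on s s' S T b \<longleftrightarrow>
     (\<forall>y\<in>T. linear_map_on s s' S (\<lambda>x. b x y)) \<and> (\<forall>x\<in>S. linear_map_on s s' T (b x))"

text \<open>
  The objects are the elements of a type. All cells live in one ambient R-module, in which the
  degree \<open>i\<close> part of the complex from \<open>U\<close> to \<open>V\<close> is the submodule \<open>Hom i U V\<close>; an arbitrary family
  of hom modules is of this form, with their direct sum as ambient module and with all operations
  extended by zero, so that these need not take the objects as arguments. The submodules are not required to be disjoint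
  or independent, and the operations are constrained only on them. A single operation \<open>\<cdot>\<close> (and
  below a single \<open>\<otimes>\<close>) covers all combinations of degrees.
\<close>

record ('o, 'r, 'a) ch_cat =
  Hom :: "int \<Rightarrow> 'o \<Rightarrow> 'o \<Rightarrow> 'a set"
  Id :: "'o \<Rightarrow> 'a" ("\<one>\<index>")
  Comp :: "'a \<Rightarrow> 'a \<Rightarrow> 'a" (infixr "\<cdot>\<index>" 75)
  Bd :: "'a \<Rightarrow> 'a" ("\<partial>\<index>")
  Smult :: "'r \<Rightarrow> 'a \<Rightarrow> 'a" (infixr "\<odot>\<index>" 80)

text \<open>
  Composites of two 2-cells lie in degree -2 and hence vanish by \<open>concentrated\<close>.
\<close>

locale ch_category =
  fixes C :: "('o, 'r::comm_ring_1, 'a::ab_group_add, 'm) ch_cat_scheme" (structure)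
  assumes module_ambient: "module (Smult C)"
    and subspace_Hom: "module.subspace (Smult C) (Hom C i U V)"
    and concentrated: "i \<notin> {-1, 0} \<Longrightarrow> Hom C i U V = {0}"
    and Bd_Hom: "\<phi> \<in> Hom C (-1) U V \<Longrightarrow> \<partial> \<phi> \<in> Hom C 0 U V"
    and Bd_linear: "linear_map_on (Smult C) (Smult C) (Hom C (-1) U V) (Bd C)"
    and Id_Hom: "\<one> U \<in> Hom C 0 U U"
    and Comp_Hom: "g \<in> Hom C j V W \<Longrightarrow> f \<in> Hom C i U V \<Longrightarrow> g \<cdot> f \<in> Hom C (j + i) U W"
    and Comp_bilinear:
      "bilinear_map_on (Smult C) (Smult C) (Hom C j V W) (Hom C i U V) (Comp C)"
    and Comp_assoc: "k \<in> Hom C l W X \<Longrightarrow> g \<in> Hom C j V W \<Longrightarrow> f \<in> Hom C i U V \<Longrightarrow>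
      (k \<cdot> g) \<cdot> f = k \<cdot> (g \<cdot> f)"
    and Id_left: "f \<in> Hom C i U V \<Longrightarrow> \<one> V \<cdot> f = f"
    and Id_right: "f \<in> Hom C i U V \<Longrightarrow> f \<cdot> \<one> U = f"
    and Bd_Comp_right: "f \<in> Hom C 0 V W \<Longrightarrow> \<phi> \<in> Hom C (-1) U V \<Longrightarrow> \<partial> (f \<cdot> \<phi>) = f \<cdot> \<partial> \<phi>"
    and Bd_Comp_left: "\<phi> \<in> Hom C (-1) V W \<Longrightarrow> f \<in> Hom C 0 U V \<Longrightarrow> \<partial> (\<phi> \<cdot> f) = \<partial> \<phi> \<cdot> f"
    and Bd_Comp_mid: "\<phi> \<in> Hom C (-1) V W \<Longrightarrow> \<psi> \<in> Hom C (-1) U V \<Longrightarrow> \<partial> \<phi> \<cdot> \<psi> = \<phi> \<cdot> \<partial> \<psi>"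

definition inv_cell ::
    "('o, 'r, 'a, 'm) ch_cat_scheme \<Rightarrow> 'o \<Rightarrow> 'o \<Rightarrow> 'a \<Rightarrow> 'a" where
  "inv_cell C U V f =
     (THE g. g \<in> Hom C 0 V U \<and> g \<cdot>\<^bsub>C\<^esub> f = \<one>\<^bsub>C\<^esub> U \<and> f \<cdot>\<^bsub>C\<^esub> g = \<one>\<^bsub>C\<^esub> V)"

text \<open>
  A functor from the product of two copies of \<open>C\<close> to \<open>D\<close>. Here and in all that follows, a linear
  map out of a truncated tensor product is given by its values on pure tensors, that is, by a
  multilinear map compatible with the relation \<open>Fc_mid\<close>; the pure tensors of total degree -1 are
  those with one factor of degree -1 and the other of degree 0.
\<close>

locale ch_bifunctor =
  C: ch_category C + D: ch_category D
  for C :: "('o, 'r::comm_ring_1, 'a::ab_group_add, 'm) ch_cat_scheme"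
    and D :: "('p, 'r, 'b::ab_group_add, 'n) ch_cat_scheme" +
  fixes Fo :: "'o \<Rightarrow> 'o \<Rightarrow> 'p" and Fc :: "'a \<Rightarrow> 'a \<Rightarrow> 'b"
  assumes Fc_Hom: "f \<in> Hom C i U U' \<Longrightarrow> g \<in> Hom C j V V' \<Longrightarrow>
      Fc f g \<in> Hom D (i + j) (Fo U V) (Fo U' V')"
    and Fc_bilinear: "bilinear_map_on (Smult C) (Smult D) (Hom C i U U') (Hom C j V V') Fc"
    and Fc_mid: "\<phi> \<in> Hom C (-1) U U' \<Longrightarrow> \<psi> \<in> Hom C (-1) V V' \<Longrightarrow>
      Fc (\<partial>\<^bsub>C\<^esub> \<phi>) \<psi> = Fc \<phi> (\<partial>\<^bsub>C\<^esub> \<psi>)"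
    and Bd_Fc_left: "\<phi> \<in> Hom C (-1) U U' \<Longrightarrow> g \<in> Hom C 0 V V' \<Longrightarrow>
      \<partial>\<^bsub>D\<^esub> (Fc \<phi> g) = Fc (\<partial>\<^bsub>C\<^esub> \<phi>) g"
    and Bd_Fc_right: "f \<in> Hom C 0 U U' \<Longrightarrow> \<psi> \<in> Hom C (-1) V V' \<Longrightarrow>
      \<partial>\<^bsub>D\<^esub> (Fc f \<psi>) = Fc f (\<partial>\<^bsub>C\<^esub> \<psi>)"
    and Fc_Id: "Fc (\<one>\<^bsub>C\<^esub> U) (\<one>\<^bsub>C\<^esub> V) = \<one>\<^bsub>D\<^esub> (Fo U V)"
    and Fc_Comp: "f' \<in> Hom C i' U' U'' \<Longrightarrow> g' \<in> Hom C j' V' V'' \<Longrightarrow>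
      f \<in> Hom C i U U' \<Longrightarrow> g \<in> Hom C j V V' \<Longrightarrow>
      Fc (f' \<cdot>\<^bsub>C\<^esub> f) (g' \<cdot>\<^bsub>C\<^esub> g) = Fc f' g' \<cdot>\<^bsub>D\<^esub> Fc f g"


section \<open>Pseudonatural transformations\<close>

text \<open>
  \<open>'i\<close> is the type of tuples of objects and \<open>'f\<close> that of tuples of 1-cells (pure tensors).
  \<open>hty \<xi> u u' f\<close> is the homotopy component at \<open>f : u \<rightarrow> u'\<close>; source and target are arguments
  because they are not determined by \<open>f\<close> as an element of the ambient module.
\<close>

record ('i, 'f, 'a) trans =
  ob :: "'i \<Rightarrow> 'a"
  hty :: "'i \<Rightarrow> 'i \<Rightarrow> 'f \<Rightarrow> 'a"

locale pseudonatural2 =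
  fixes C :: "('o, 'r::comm_ring_1, 'a::ab_group_add, 'm) ch_cat_scheme"
    and D :: "('p, 'r, 'b::ab_group_add, 'n) ch_cat_scheme"
    and Fo :: "'o \<Rightarrow> 'o \<Rightarrow> 'p" and Fc :: "'a \<Rightarrow> 'a \<Rightarrow> 'b"
    and Go :: "'o \<Rightarrow> 'o \<Rightarrow> 'p" and Gc :: "'a \<Rightarrow> 'a \<Rightarrow> 'b"
    and \<xi> :: "('o \<times> 'o, 'a \<times> 'a, 'b) trans"
  assumes ob_Hom: "ob \<xi> (U, V) \<in> Hom D 0 (Fo U V) (Go U V)"
    and hty_Hom: "f \<in> Hom C 0 U U' \<Longrightarrow> g \<in> Hom C 0 V V' \<Longrightarrow>
      hty \<xi> (U, V) (U', V') (f, g) \<in> Hom D (-1) (Fo U V) (Go U' V')"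
    and hty_bilinear: "bilinear_map_on (Smult C) (Smult D) (Hom C 0 U U') (Hom C 0 V V')
      (\<lambda>f g. hty \<xi> (U, V) (U', V') (f, g))"
    and natural_1: "f \<in> Hom C 0 U U' \<Longrightarrow> g \<in> Hom C 0 V V' \<Longrightarrow>
      Gc f g \<cdot>\<^bsub>D\<^esub> ob \<xi> (U, V) - ob \<xi> (U', V') \<cdot>\<^bsub>D\<^esub> Fc f g
        = \<partial>\<^bsub>D\<^esub> (hty \<xi> (U, V) (U', V') (f, g))"
    and natural_2_left: "\<phi> \<in> Hom C (-1) U U' \<Longrightarrow> g \<in> Hom C 0 V V' \<Longrightarrow>
      Gc \<phi> g \<cdot>\<^bsub>D\<^esub> ob \<xi> (U, V) - ob \<xi> (U', V') \<cdot>\<^bsub>D\<^esub> Fc \<phi> g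
        = hty \<xi> (U, V) (U', V') (\<partial>\<^bsub>C\<^esub> \<phi>, g)"
    and natural_2_right: "f \<in> Hom C 0 U U' \<Longrightarrow> \<psi> \<in> Hom C (-1) V V' \<Longrightarrow>
      Gc f \<psi> \<cdot>\<^bsub>D\<^esub> ob \<xi> (U, V) - ob \<xi> (U', V') \<cdot>\<^bsub>D\<^esub> Fc f \<psi>
        = hty \<xi> (U, V) (U', V') (f, \<partial>\<^bsub>C\<^esub> \<psi>)"
    and hty_Id: "hty \<xi> (U, V) (U, V) (\<one>\<^bsub>C\<^esub> U, \<one>\<^bsub>C\<^esub> V) = 0"
    and hty_Comp: "f' \<in> Hom C 0 U' U'' \<Longrightarrow> g' \<in> Hom C 0 V' V'' \<Longrightarrow>
      f \<in> Hom C 0 U U' \<Longrightarrow> g \<in> Hom C 0 V V' \<Longrightarrow>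
      hty \<xi> (U, V) (U'', V'') (f' \<cdot>\<^bsub>C\<^esub> f, g' \<cdot>\<^bsub>C\<^esub> g)
        = hty \<xi> (U', V') (U'', V'') (f', g') \<cdot>\<^bsub>D\<^esub> Fc f g
          + Gc f' g' \<cdot>\<^bsub>D\<^esub> hty \<xi> (U, V) (U', V') (f, g)"

definition natural_trans :: "('i \<Rightarrow> 'a) \<Rightarrow> ('i, 'f, 'a::zero) trans" where
  "natural_trans c = \<lparr>ob = c, hty = (\<lambda>u u' f. 0)\<rparr>"

text \<open>The identity transformation of a functor with object map \<open>Fo\<close>.\<close>

definition id_trans ::
    "('o, 'r, 'a::zero, 'm) ch_cat_scheme \<Rightarrow> ('i \<Rightarrow> 'o) \<Rightarrow> ('i, 'f, 'a) trans" where
  "id_trans C Fo = natural_trans (\<lambda>u. \<one>\<^bsub>C\<^esub> (Fo u))"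

definition vcomp_trans ::
    "('o, 'r, 'a::plus, 'm) ch_cat_scheme \<Rightarrow>
      ('i, 'f, 'a) trans \<Rightarrow> ('i, 'f, 'a) trans \<Rightarrow> ('i, 'f, 'a) trans" where
  "vcomp_trans C \<theta> \<xi> =
     \<lparr>ob = (\<lambda>u. ob \<theta> u \<cdot>\<^bsub>C\<^esub> ob \<xi> u),
      hty = (\<lambda>u u' f. hty \<theta> u u' f \<cdot>\<^bsub>C\<^esub> ob \<xi> u + ob \<theta> u' \<cdot>\<^bsub>C\<^esub> hty \<xi> u u' f)\<rparr>"

definition add_trans ::
    "('i, 'f, 'a::plus) trans \<Rightarrow> ('i, 'f, 'a) trans \<Rightarrow> ('i, 'f, 'a) trans" where
  "add_trans \<theta> \<xi> =
     \<lparr>ob = (\<lambda>u. ob \<theta> u + ob \<xi> u), hty = (\<lambda>u u' f. hty \<theta> u u' f + hty \<xi> u u' f)\<rparr>"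

definition diff_trans ::
    "('i, 'f, 'a::minus) trans \<Rightarrow> ('i, 'f, 'a) trans \<Rightarrow> ('i, 'f, 'a) trans" where
  "diff_trans \<theta> \<xi> =
     \<lparr>ob = (\<lambda>u. ob \<theta> u - ob \<xi> u), hty = (\<lambda>u u' f. hty \<theta> u u' f - hty \<xi> u u' f)\<rparr>"

definition scale_trans ::
    "('o, 'r, 'a, 'm) ch_cat_scheme \<Rightarrow> 'r \<Rightarrow> ('i, 'f, 'a) trans \<Rightarrow> ('i, 'f, 'a) trans" where
  "scale_trans C c \<xi> =
     \<lparr>ob = (\<lambda>u. c \<odot>\<^bsub>C\<^esub> ob \<xi> u), hty = (\<lambda>u u' f. c \<odot>\<^bsub>C\<^esub> hty \<xi> u u' f)\<rparr>"

definition commutator_trans ::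
    "('o, 'r, 'a::{plus,minus}, 'm) ch_cat_scheme \<Rightarrow>
      ('i, 'f, 'a) trans \<Rightarrow> ('i, 'f, 'a) trans \<Rightarrow> ('i, 'f, 'a) trans" where
  "commutator_trans C \<xi> \<theta> = diff_trans (vcomp_trans C \<xi> \<theta>) (vcomp_trans C \<theta> \<xi>)"

text \<open>
  The inverse of a transformation with invertible \<open>ob\<close> components between functors with object
  maps \<open>Fo\<close> and \<open>Go\<close>.
\<close>

definition inv_trans ::
    "('o, 'r, 'a::uminus, 'm) ch_cat_scheme \<Rightarrow> ('i \<Rightarrow> 'o) \<Rightarrow> ('i \<Rightarrow> 'o) \<Rightarrow>
      ('i, 'f, 'a) trans \<Rightarrow> ('i, 'f, 'a) trans" where
  "inv_trans C Fo Go \<xi> =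
     \<lparr>ob = (\<lambda>u. inv_cell C (Fo u) (Go u) (ob \<xi> u)),
      hty = (\<lambda>u u' f. - (inv_cell C (Fo u') (Go u') (ob \<xi> u')
                \<cdot>\<^bsub>C\<^esub> hty \<xi> u u' f \<cdot>\<^bsub>C\<^esub> inv_cell C (Fo u) (Go u) (ob \<xi> u)))\<rparr>"


section \<open>Symmetric strict monoidal categories\<close>

record ('o, 'r, 'a) mon_cat = "('o, 'r, 'a) ch_cat" +
  Obt :: "'o \<Rightarrow> 'o \<Rightarrow> 'o" (infixr "\<star>\<index>" 80)
  Unt :: "'o"
  Tens :: "'a \<Rightarrow> 'a \<Rightarrow> 'a" (infixr "\<otimes>\<index>" 70)

record ('o, 'r, 'a) sym_mon_cat = "('o, 'r, 'a) mon_cat" +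
  Sym :: "'o \<Rightarrow> 'o \<Rightarrow> 'a" ("\<gamma>\<index>")

locale sym_strict_mon_ch_category =
  ch_bifunctor C C "Obt C" "Tens C"
  for C :: "('o, 'r::comm_ring_1, 'a::ab_group_add, 'm) sym_mon_cat_scheme" (structure) +
  assumes Obt_assoc: "(U \<star> V) \<star> W = U \<star> (V \<star> W)"
    and Obt_Unt_left: "Unt C \<star> U = U"
    and Obt_Unt_right: "U \<star> Unt C = U"
    and Tens_assoc: "f \<in> Hom C i U U' \<Longrightarrow> g \<in> Hom C j V V' \<Longrightarrow> k \<in> Hom C l W W' \<Longrightarrow>
      (f \<otimes> g) \<otimes> k = f \<otimes> (g \<otimes> k)"
    and Tens_Unt_left: "f \<in> Hom C i U U' \<Longrightarrow> \<one> (Unt C) \<otimes> f = f"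
    and Tens_Unt_right: "f \<in> Hom C i U U' \<Longrightarrow> f \<otimes> \<one> (Unt C) = f"
    and Sym_natural: "pseudonatural2 C C (Obt C) (Tens C) (\<lambda>U V. V \<star> U) (\<lambda>f g. g \<otimes> f)
      (natural_trans (\<lambda>(U, V). \<gamma> U V))"
    and Sym_invol: "\<gamma> V U \<cdot> \<gamma> U V = \<one> (U \<star> V)"
    and Sym_hexagon: "\<gamma> U (V \<star> W) = (\<one> V \<otimes> \<gamma> U W) \<cdot> (\<gamma> U V \<otimes> \<one> W)"


section \<open>Infinitesimal 2-braidings\<close>

definition inf_2_braiding ::
    "('o, 'r::comm_ring_1, 'a::ab_group_add, 'm) sym_mon_cat_scheme \<Rightarrow>
      ('o \<times> 'o, 'a \<times> 'a, 'a) trans \<Rightarrow> bool" where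
  "inf_2_braiding C t \<longleftrightarrow> pseudonatural2 C C (Obt C) (Tens C) (Obt C) (Tens C) t"

locale strict_inf_2_braiding =
  fixes C :: "('o, 'r::comm_ring_1, 'a::ab_group_add, 'm) sym_mon_cat_scheme" (structure)
    and t :: "('o \<times> 'o, 'a \<times> 'a, 'a) trans"
  assumes braiding: "inf_2_braiding C t"
    and strict_ob_right:
      "ob t (U, V \<star> W) =
         (ob t (U, V) \<otimes> \<one> W)
         + (\<gamma> V U \<otimes> \<one> W) \<cdot> (\<one> V \<otimes> ob t (U, W)) \<cdot> (\<gamma> U V \<otimes> \<one> W)"
    and strict_hty_right:
      "f \<in> Hom C 0 U U' \<Longrightarrow> g \<in> Hom C 0 V V' \<Longrightarrow> k \<in> Hom C 0 W W' \<Longrightarrow>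
       hty t (U, V \<star> W) (U', V' \<star> W') (f, g \<otimes> k) =
         (hty t (U, V) (U', V') (f, g) \<otimes> k)
         + (\<gamma> V' U' \<otimes> \<one> W') \<cdot> (g \<otimes> hty t (U, W) (U', W') (f, k)) \<cdot> (\<gamma> U V \<otimes> \<one> W)"
    and strict_ob_left:
      "ob t (U \<star> V, W) =
         (\<one> U \<otimes> ob t (V, W))
         + (\<one> U \<otimes> \<gamma> W V) \<cdot> (ob t (U, W) \<otimes> \<one> V) \<cdot> (\<one> U \<otimes> \<gamma> V W)"
    and strict_hty_left:
      "f \<in> Hom C 0 U U' \<Longrightarrow> g \<in> Hom C 0 V V' \<Longrightarrow> k \<in> Hom C 0 W W' \<Longrightarrow>
       hty t (U \<star> V, W) (U' \<star> V', W') (f \<otimes> g, k) =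
         (f \<otimes> hty t (V, W) (V', W') (g, k))
         + (\<one> U' \<otimes> \<gamma> W' V') \<cdot> (hty t (U, W) (U', W') (f, k) \<otimes> g) \<cdot> (\<one> U \<otimes> \<gamma> V W)"

locale symmetric_inf_2_braiding =
  fixes C :: "('o, 'r::comm_ring_1, 'a::ab_group_add, 'm) sym_mon_cat_scheme" (structure)
    and t :: "('o \<times> 'o, 'a \<times> 'a, 'a) trans"
  assumes braiding: "inf_2_braiding C t"
    and symmetric_ob: "\<gamma> U V \<cdot> ob t (U, V) = ob t (V, U) \<cdot> \<gamma> U V"
    and symmetric_hty: "f \<in> Hom C 0 U U' \<Longrightarrow> g \<in> Hom C 0 V V' \<Longrightarrow>
      \<gamma> U' V' \<cdot> hty t (U, V) (U', V') (f, g) = hty t (V, U) (V', U') (g, f) \<cdot> \<gamma> U V"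

locale totally_symmetric_inf_2_braiding = symmetric_inf_2_braiding +
  assumes totally_symmetric: "hty t (U \<star> V, W) (V \<star> U, W) (\<gamma> U V, \<one> W) = 0"

text \<open>Transformations between functors in three arguments.\<close>

abbreviation Obt3 :: "('o, 'r, 'a, 'm) mon_cat_scheme \<Rightarrow> 'o \<times> 'o \<times> 'o \<Rightarrow> 'o" where
  "Obt3 C \<equiv> (\<lambda>(U, V, W). U \<star>\<^bsub>C\<^esub> V \<star>\<^bsub>C\<^esub> W)"

definition trans_12 ::
    "('o, 'r, 'a, 'm) mon_cat_scheme \<Rightarrow> ('o \<times> 'o, 'a \<times> 'a, 'a) trans \<Rightarrow>
      ('o \<times> 'o \<times> 'o, 'a \<times> 'a \<times> 'a, 'a) trans" where
  "trans_12 C t =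
     \<lparr>ob = (\<lambda>(U, V, W). ob t (U, V) \<otimes>\<^bsub>C\<^esub> \<one>\<^bsub>C\<^esub> W),
      hty = (\<lambda>(U, V, W) (U', V', W') (f, g, k). hty t (U, V) (U', V') (f, g) \<otimes>\<^bsub>C\<^esub> k)\<rparr>"

definition trans_23 ::
    "('o, 'r, 'a, 'm) mon_cat_scheme \<Rightarrow> ('o \<times> 'o, 'a \<times> 'a, 'a) trans \<Rightarrow>
      ('o \<times> 'o \<times> 'o, 'a \<times> 'a \<times> 'a, 'a) trans" where
  "trans_23 C t =
     \<lparr>ob = (\<lambda>(U, V, W). \<one>\<^bsub>C\<^esub> U \<otimes>\<^bsub>C\<^esub> ob t (V, W)),
      hty = (\<lambda>(U, V, W) (U', V', W') (f, g, k). f \<otimes>\<^bsub>C\<^esub> hty t (V, W) (V', W') (g, k))\<rparr>"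

text \<open>The four-term relationators.\<close>

definition relator_L ::
    "('o, 'r, 'a, 'm) mon_cat_scheme \<Rightarrow> ('o \<times> 'o, 'a \<times> 'a, 'a) trans \<Rightarrow>
      'o \<Rightarrow> 'o \<Rightarrow> 'o \<Rightarrow> 'a" where
  "relator_L C t U V W =
     hty t (U \<star>\<^bsub>C\<^esub> V, W) (U \<star>\<^bsub>C\<^esub> V, W) (ob t (U, V), \<one>\<^bsub>C\<^esub> W)"

definition relator_R ::
    "('o, 'r, 'a, 'm) mon_cat_scheme \<Rightarrow> ('o \<times> 'o, 'a \<times> 'a, 'a) trans \<Rightarrow>
      'o \<Rightarrow> 'o \<Rightarrow> 'o \<Rightarrow> 'a" where
  "relator_R C t U V W =
     hty t (U, V \<star>\<^bsub>C\<^esub> W) (U, V \<star>\<^bsub>C\<^esub> W) (\<one>\<^bsub>C\<^esub> U, ob t (V, W))"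


section \<open>Base change to K[h]/(h^3)\<close>

definition base_change ::
    "('o, 'k::comm_ring_1, 'a::ab_group_add) sym_mon_cat \<Rightarrow>
      ('o, 'k trunc, 'a trunc) sym_mon_cat" where
  "base_change C =
     \<lparr>Hom = (\<lambda>i U V. {Tr a b c | a b c. a \<in> Hom C i U V \<and> b \<in> Hom C i U V \<and> c \<in> Hom C i U V}),
      Id = (\<lambda>U. cst (\<one>\<^bsub>C\<^esub> U)),
      Comp = ext2 (Comp C),
      Bd = map_trunc (Bd C),
      Smult = ext2 (Smult C),
      Obt = Obt C,
      Unt = Unt C,
      Tens = ext2 (Tens C),
      Sym = (\<lambda>U V. cst (\<gamma>\<^bsub>C\<^esub> U V))\<rparr>"

definition base_change_trans ::
    "('o \<times> 'o, 'a \<times> 'a, 'a::ab_group_add) trans \<Rightarrow>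
      ('o \<times> 'o, 'a trunc \<times> 'a trunc, 'a trunc) trans" where
  "base_change_trans t =
     \<lparr>ob = (\<lambda>u. cst (ob t u)),
      hty = (\<lambda>u u' (f, g). ext2 (\<lambda>x y. hty t u u' (x, y)) f g)\<rparr>"


section \<open>Braided data with trivial pentagonator\<close>

record ('o, 'r, 'a) braided_data = "('o, 'r, 'a) mon_cat" +
  Assoc :: "('o \<times> 'o \<times> 'o, 'a \<times> 'a \<times> 'a, 'a) trans"
  Braid :: "('o \<times> 'o, 'a \<times> 'a, 'a) trans"
  HexL :: "'o \<Rightarrow> 'o \<Rightarrow> 'o \<Rightarrow> 'a"
  HexR :: "'o \<Rightarrow> 'o \<Rightarrow> 'o \<Rightarrow> 'a"

context
  fixes B :: "('o, 'r, 'a::ab_group_add, 'm) braided_data_scheme" (structure)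
begin

text \<open>
  In the axioms, \<open>\<alpha>\<close>, \<open>\<beta>\<close> and \<open>\<sigma>\<close> denote the \<open>ob\<close> components of the associator, of its inverse and
  of the braiding; \<open>\<alpha>h\<close>, \<open>\<beta>h\<close> and \<open>\<sigma>h\<close> denote their homotopy components.
\<close>

private abbreviation (input) \<alpha> where "\<alpha> U V W \<equiv> ob (Assoc B) (U, V, W)"
private abbreviation (input) \<alpha>h where "\<alpha>h \<equiv> hty (Assoc B)"
private abbreviation (input) \<beta> where
  "\<beta> U V W \<equiv> ob (inv_trans B (Obt3 B) (Obt3 B) (Assoc B)) (U, V, W)"
private abbreviation (input) \<beta>h where
  "\<beta>h \<equiv> hty (inv_trans B (Obt3 B) (Obt3 B) (Assoc B))"
private abbreviation (input) \<sigma> where "\<sigma> U V \<equiv> ob (Braid B) (U, V)"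
private abbreviation (input) \<sigma>h where "\<sigma>h \<equiv> hty (Braid B)"
private abbreviation (input) HL where "HL \<equiv> HexL B"
private abbreviation (input) HR where "HR \<equiv> HexR B"

definition left_tetrahedron :: bool where
  "left_tetrahedron \<longleftrightarrow> (\<forall>U V W X.
      (\<one> V \<otimes> \<alpha> W X U) \<cdot> \<alpha> V (W \<star> X) U
        \<cdot> \<sigma>h (U, V \<star> W \<star> X) (U, V \<star> W \<star> X) (\<one> U, \<alpha> V W X)
        \<cdot> \<alpha> U (V \<star> W) X \<cdot> (\<alpha> U V W \<otimes> \<one> X)
      + (\<one> V \<otimes> \<alpha> W X U) \<cdot> HL U V (W \<star> X) \<cdot> \<alpha> (U \<star> V) W X
      + (\<one> V \<otimes> \<alpha> W X U \<cdot> \<sigma> U (W \<star> X)) \<cdot> \<alpha> V U (W \<star> X)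
        \<cdot> \<alpha>h (U \<star> V, W, X) (V \<star> U, W, X) (\<sigma> U V, \<one> W, \<one> X)
    = \<alpha> V W (X \<star> U) \<cdot> HL U (V \<star> W) X \<cdot> (\<alpha> U V W \<otimes> \<one> X)
      - \<alpha>h (V, W, U \<star> X) (V, W, X \<star> U) (\<one> V, \<one> W, \<sigma> U X)
        \<cdot> \<alpha> (V \<star> W) U X \<cdot> (\<sigma> U (V \<star> W) \<cdot> \<alpha> U V W \<otimes> \<one> X)
      + (\<one> V \<otimes> (\<one> W \<otimes> \<sigma> U X) \<cdot> \<alpha> W U X) \<cdot> \<alpha> V (W \<star> U) X \<cdot> (HL U V W \<otimes> \<one> X)
      - (\<one> V \<otimes> HL U W X) \<cdot> \<alpha> V (U \<star> W) X \<cdot> (\<alpha> V U W \<cdot> (\<sigma> U V \<otimes> \<one> W) \<otimes> \<one> X)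
      - (\<one> V \<otimes> (\<one> W \<otimes> \<sigma> U X) \<cdot> \<alpha> W U X)
        \<cdot> \<alpha>h (V, U \<star> W, X) (V, W \<star> U, X) (\<one> V, \<sigma> U W, \<one> X)
        \<cdot> (\<alpha> V U W \<cdot> (\<sigma> U V \<otimes> \<one> W) \<otimes> \<one> X))"

definition right_tetrahedron :: bool where
  "right_tetrahedron \<longleftrightarrow> (\<forall>U V W X.
      (\<beta> X U V \<otimes> \<one> W) \<cdot> \<beta> X (U \<star> V) W
        \<cdot> \<sigma>h (U \<star> V \<star> W, X) (U \<star> V \<star> W, X) (\<beta> U V W, \<one> X)
        \<cdot> \<beta> U (V \<star> W) X \<cdot> (\<one> U \<otimes> \<beta> V W X)
      + (\<beta> X U V \<otimes> \<one> W) \<cdot> HR (U \<star> V) W X \<cdot> \<beta> U V (W \<star> X)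
      + (\<beta> X U V \<cdot> \<sigma> (U \<star> V) X \<otimes> \<one> W) \<cdot> \<beta> (U \<star> V) X W
        \<cdot> \<beta>h (U, V, W \<star> X) (U, V, X \<star> W) (\<one> U, \<one> V, \<sigma> W X)
    = \<beta> (X \<star> U) V W \<cdot> HR U (V \<star> W) X \<cdot> (\<one> U \<otimes> \<beta> V W X)
      - ((\<sigma> U X \<otimes> \<one> V) \<cdot> \<beta> U X V \<otimes> \<one> W)
        \<cdot> \<beta>h (U, V \<star> X, W) (U, X \<star> V, W) (\<one> U, \<sigma> V X, \<one> W)
        \<cdot> (\<one> U \<otimes> \<beta> V X W \<cdot> (\<one> V \<otimes> \<sigma> W X))
      - \<beta>h (U \<star> X, V, W) (X \<star> U, V, W) (\<sigma> U X, \<one> V, \<one> W)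
        \<cdot> \<beta> U X (V \<star> W) \<cdot> (\<one> U \<otimes> \<sigma> (V \<star> W) X \<cdot> \<beta> V W X)
      + ((\<sigma> U X \<otimes> \<one> V) \<cdot> \<beta> U X V \<otimes> \<one> W) \<cdot> \<beta> U (X \<star> V) W \<cdot> (\<one> U \<otimes> HR V W X)
      - (HR U V X \<otimes> \<one> W) \<cdot> \<beta> U (V \<star> X) W \<cdot> (\<one> U \<otimes> \<beta> V X W \<cdot> (\<one> V \<otimes> \<sigma> W X)))"

definition hexahedron :: bool where
  "hexahedron \<longleftrightarrow> (\<forall>U V W X.
      \<alpha> W (X \<star> U) V \<cdot> (\<alpha> W X U \<otimes> \<one> V) \<cdot> HR U V (W \<star> X)
        \<cdot> (\<one> U \<otimes> \<alpha> V W X) \<cdot> \<alpha> U (V \<star> W) X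
      - (\<one> W \<otimes> \<beta> X U V) \<cdot> HL (U \<star> V) W X \<cdot> (\<beta> U V W \<otimes> \<one> X)
    = (\<one> W \<otimes> HR U V X) \<cdot> \<alpha> W U (V \<star> X) \<cdot> \<alpha> (W \<star> U) V X
        \<cdot> (\<beta> W U V \<cdot> \<sigma> (U \<star> V) W \<cdot> \<beta> U V W \<otimes> \<one> X)
      + (\<one> W \<otimes> (\<sigma> U X \<otimes> \<one> V) \<cdot> \<beta> U X V \<cdot> (\<one> U \<otimes> \<sigma> V X)) \<cdot> \<alpha> W U (V \<star> X)
        \<cdot> (\<alpha> (W \<star> U) V X \<cdot> (HR U V W \<otimes> \<one> X)
           - \<alpha>h (U \<star> W, V, X) (W \<star> U, V, X) (\<sigma> U W, \<one> V, \<one> X)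
             \<cdot> (\<beta> U W V \<cdot> (\<one> U \<otimes> \<sigma> V W) \<otimes> \<one> X))
      + (\<one> W \<otimes> (\<sigma> U X \<otimes> \<one> V) \<cdot> \<beta> U X V)
        \<cdot> \<alpha>h (W, U, V \<star> X) (W, U, X \<star> V) (\<one> W, \<one> U, \<sigma> V X)
        \<cdot> (\<sigma> U W \<otimes> \<one> (V \<star> X)) \<cdot> \<alpha> (U \<star> W) V X
        \<cdot> (\<beta> U W V \<cdot> (\<one> U \<otimes> \<sigma> V W) \<otimes> \<one> X)
      + \<alpha>h (W, U \<star> X, V) (W, X \<star> U, V) (\<one> W, \<sigma> U X, \<one> V)
        \<cdot> (\<alpha> W U X \<otimes> \<one> V) \<cdot> \<beta> (W \<star> U) X V \<cdot> (\<sigma> U W \<otimes> \<sigma> V X)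
        \<cdot> \<alpha> (U \<star> W) V X \<cdot> (\<beta> U W V \<cdot> (\<one> U \<otimes> \<sigma> V W) \<otimes> \<one> X)
      - \<alpha> W (X \<star> U) V \<cdot> ((\<one> W \<otimes> \<sigma> U X) \<cdot> \<alpha> W U X \<otimes> \<one> V) \<cdot> \<beta> (W \<star> U) X V
        \<cdot> (\<sigma> U W \<otimes> \<sigma> V X) \<cdot> \<beta> U W (V \<star> X) \<cdot> (\<one> U \<otimes> \<alpha> W V X)
        \<cdot> \<alpha>h (U, V \<star> W, X) (U, W \<star> V, X) (\<one> U, \<sigma> V W, \<one> X)
      - \<alpha> W (X \<star> U) V \<cdot> ((\<one> W \<otimes> \<sigma> U X) \<cdot> \<alpha> W U X \<otimes> \<one> V)
        \<cdot> \<beta>h (U \<star> W, X, V) (W \<star> U, X, V) (\<sigma> U W, \<one> X, \<one> V)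
        \<cdot> (\<one> (U \<star> W) \<otimes> \<sigma> V X) \<cdot> \<beta> U W (V \<star> X)
        \<cdot> (\<one> U \<otimes> \<alpha> W V X \<cdot> (\<sigma> V W \<otimes> \<one> X)) \<cdot> \<alpha> U (V \<star> W) X
      + \<alpha> W (X \<star> U) V \<cdot> ((\<one> W \<otimes> \<sigma> U X) \<cdot> \<alpha> W U X \<cdot> (\<sigma> U W \<otimes> \<one> X) \<otimes> \<one> V)
        \<cdot> \<beta> (U \<star> W) X V \<cdot> \<beta>h (U, W, V \<star> X) (U, W, X \<star> V) (\<one> U, \<one> W, \<sigma> V X)
        \<cdot> (\<one> U \<otimes> \<alpha> W V X \<cdot> (\<sigma> V W \<otimes> \<one> X)) \<cdot> \<alpha> U (V \<star> W) X
      - \<alpha> W (X \<star> U) V \<cdot> (HL U W X \<otimes> \<one> V) \<cdot> \<beta> (U \<star> W) X V \<cdot> \<beta> U W (X \<star> V)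
        \<cdot> (\<one> U \<otimes> (\<one> W \<otimes> \<sigma> V X) \<cdot> \<alpha> W V X \<cdot> (\<sigma> V W \<otimes> \<one> X)) \<cdot> \<alpha> U (V \<star> W) X
      - \<alpha> W (X \<star> U) V \<cdot> (\<alpha> W X U \<cdot> \<sigma> U (W \<star> X) \<cdot> \<alpha> U W X \<otimes> \<one> V)
        \<cdot> \<beta> (U \<star> W) X V \<cdot> \<beta> U W (X \<star> V) \<cdot> (\<one> U \<otimes> HL V W X) \<cdot> \<alpha> U (V \<star> W) X)"

end


section \<open>The deformed data\<close>

text \<open>
  In \<open>exp_half_trans\<close> and \<open>braided_data_of\<close> the category \<open>C\<close> is already defined over K[h]/(h^3), so
  that exp((h/2) t) is the polynomial 1 + (h/2) t + (h^2/8) t^2, with vertical composition as product.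
\<close>

definition exp_half_trans ::
    "('o, 'k::field trunc, 'a::ab_group_add, 'm) mon_cat_scheme \<Rightarrow>
      ('o \<times> 'o, 'f, 'a) trans \<Rightarrow> ('o \<times> 'o, 'f, 'a) trans" where
  "exp_half_trans C t =
     add_trans (add_trans (id_trans C (\<lambda>(U, V). U \<star>\<^bsub>C\<^esub> V))
         (scale_trans C (cst (1/2) * hh) t))
       (scale_trans C (cst (1/8) * hh ^ 2) (vcomp_trans C t t))"

definition braided_data_of ::
    "('o, 'k::field trunc, 'a::ab_group_add, 'm) sym_mon_cat_scheme \<Rightarrow>
      ('o \<times> 'o, 'a \<times> 'a, 'a) trans \<Rightarrow> ('o, 'k trunc, 'a) braided_data" where
  "braided_data_of C t =
     \<lparr>Hom = Hom C, Id = Id C, Comp = Comp C, Bd = Bd C, Smult = Smult C,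
      Obt = Obt C, Unt = Unt C, Tens = Tens C,
      Assoc = add_trans (id_trans C (Obt3 C))
        (scale_trans C (cst (1/24) * hh ^ 2) (commutator_trans C (trans_12 C t) (trans_23 C t))),
      Braid = vcomp_trans C (natural_trans (\<lambda>(U, V). \<gamma>\<^bsub>C\<^esub> U V)) (exp_half_trans C t),
      HexL = (\<lambda>U V W. (cst (1/24) * hh ^ 2) \<odot>\<^bsub>C\<^esub>
        (\<gamma>\<^bsub>C\<^esub> U (V \<star>\<^bsub>C\<^esub> W) \<cdot>\<^bsub>C\<^esub> (2 \<odot>\<^bsub>C\<^esub> relator_L C t U V W + relator_R C t U V W))),
      HexR = (\<lambda>U V W. (cst (1/24) * hh ^ 2) \<odot>\<^bsub>C\<^esub>
        (\<gamma>\<^bsub>C\<^esub> (U \<star>\<^bsub>C\<^esub> V) W \<cdot>\<^bsub>C\<^esub> (relator_L C t U V W + 2 \<odot>\<^bsub>C\<^esub> relator_R C t U V W)))\<rparr>"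

definition deformed_data ::
    "('o, 'k::field, 'a::ab_group_add) sym_mon_cat \<Rightarrow> ('o \<times> 'o, 'a \<times> 'a, 'a) trans \<Rightarrow>
      ('o, 'k trunc, 'a trunc) braided_data" where
  "deformed_data C t = braided_data_of (base_change C) (base_change_trans t)"

end

theory Submission
  imports Defs
begin

text \<open>
  All three axioms are identities between 2-cells with coefficients in K[h]/(h^3). Every summand
  contains exactly one factor of degree -1, and all these factors are divisible by h^2. Therefore
  only the coefficients of h^0 of the other factors count, so that \<open>\<alpha>\<close> and its inverse may be
  replaced by identities and \<open>\<sigma>\<close> by \<open>\<gamma>\<close>. There are three kinds of factors of degree -1.

  \<^item> The homotopy components of \<open>\<alpha>\<close> and of its inverse at \<open>\<sigma>\<close> and identities. Their
    coefficient of h^2 is built from values of the homotopy components of t at \<open>\<gamma>\<close> and identities.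
    All of these vanish by total symmetry (\<open>t_hty_swap\<close>), hence so do these factors
    (\<open>leading_assoc_hty\<close>, \<open>leading_assoc_inv_hty\<close>).
  \<^item> The homotopy components of \<open>\<sigma>\<close> at an identity and a component of \<open>\<alpha>\<close> or of its inverse.
    They are O(h^3), because these 1-cells are 1 + O(h^2), the homotopy components of t vanish at
    identities, and those of \<open>\<sigma>\<close> carry a further factor h (\<open>braid_hty_near_unit\<close>).
  \<^item> The hexagonators, which are h^2/24 times \<open>\<gamma>\<close> composed with h^L = 2L + R or h^R = L + 2R.

  What remains is an identity between the hexagonators. Write \<open>T\<^sub>1\<^sub>2\<^sub>4\<close> for the cell \<open>T U V X\<close> acting
  on the first, second and fourth factor of UVWX, and so on. Strictness of t, together with the
  vanishing of its homotopy components at \<open>\<gamma>\<close>, yields for both T = L and T = R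

  \<open>T\<^sub>(\<^sub>1\<^sub>2\<^sub>)\<^sub>3\<^sub>4 = T\<^sub>1\<^sub>3\<^sub>4 + T\<^sub>2\<^sub>3\<^sub>4\<close>, \<open>T\<^sub>1\<^sub>(\<^sub>2\<^sub>3\<^sub>)\<^sub>4 = T\<^sub>1\<^sub>2\<^sub>4 + T\<^sub>1\<^sub>3\<^sub>4\<close>, \<open>T\<^sub>1\<^sub>2\<^sub>(\<^sub>3\<^sub>4\<^sub>) = T\<^sub>1\<^sub>2\<^sub>3 + T\<^sub>1\<^sub>2\<^sub>4\<close>

  (\<open>triadditive_rel_L\<close>, \<open>triadditive_rel_R\<close>), and hence for all linear combinations of L and R.
  After cancelling the symmetry, the three axioms read, with S = h^R and T = h^L,

  \<open>T\<^sub>1\<^sub>2\<^sub>(\<^sub>3\<^sub>4\<^sub>) = T\<^sub>1\<^sub>(\<^sub>2\<^sub>3\<^sub>)\<^sub>4 + T\<^sub>1\<^sub>2\<^sub>3 - T\<^sub>1\<^sub>3\<^sub>4\<close>,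

  \<open>S\<^sub>(\<^sub>1\<^sub>2\<^sub>)\<^sub>3\<^sub>4 = S\<^sub>1\<^sub>(\<^sub>2\<^sub>3\<^sub>)\<^sub>4 + S\<^sub>2\<^sub>3\<^sub>4 - S\<^sub>1\<^sub>2\<^sub>4\<close>,

  \<open>S\<^sub>1\<^sub>2\<^sub>(\<^sub>3\<^sub>4\<^sub>) - T\<^sub>(\<^sub>1\<^sub>2\<^sub>)\<^sub>3\<^sub>4 = S\<^sub>1\<^sub>2\<^sub>4 + S\<^sub>1\<^sub>2\<^sub>3 - T\<^sub>1\<^sub>3\<^sub>4 - T\<^sub>2\<^sub>3\<^sub>4\<close>,

  and all three follow at once from additivity.
\<close>

section \<open>Cells with degree, source and target\<close>

text \<open>
  An element of the ambient module does not determine the hom module in which it is considered,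
  while the laws of the category hold on hom modules only. Recording degree and ends along with
  the cell turns each law into a conditional equation whose conditions are checked by computing
  the degrees and ends of both sides, so that diagrams can be evaluated by rewriting.
\<close>

datatype ('o, 'a) arrow = Arrow (deg: int) (src: 'o) (tgt: 'o) (cell: 'a)

context sym_strict_mon_ch_category
begin

definition wt :: "('o, 'a) arrow \<Rightarrow> bool" where
  "wt a \<longleftrightarrow> cell a \<in> Hom C (deg a) (src a) (tgt a)"

definition acomp :: "('o, 'a) arrow \<Rightarrow> ('o, 'a) arrow \<Rightarrow> ('o, 'a) arrow" (infixr "\<bullet>" 75) where
  "a \<bullet> b = Arrow (deg a + deg b) (src b) (tgt a) (cell a \<cdot> cell b)"

definition atens :: "('o, 'a) arrow \<Rightarrow> ('o, 'a) arrow \<Rightarrow> ('o, 'a) arrow" (infixr "\<otimes>\<^sub>a" 80) where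
  "a \<otimes>\<^sub>a b = Arrow (deg a + deg b) (src a \<star> src b) (tgt a \<star> tgt b) (cell a \<otimes> cell b)"

definition aplus :: "('o, 'a) arrow \<Rightarrow> ('o, 'a) arrow \<Rightarrow> ('o, 'a) arrow" (infixl "+\<^sub>a" 65) where
  "a +\<^sub>a b = Arrow (deg a) (src a) (tgt a) (cell a + cell b)"

definition aminus :: "('o, 'a) arrow \<Rightarrow> ('o, 'a) arrow \<Rightarrow> ('o, 'a) arrow" (infixl "-\<^sub>a" 65) where
  "a -\<^sub>a b = Arrow (deg a) (src a) (tgt a) (cell a - cell b)"

definition ascale :: "'r \<Rightarrow> ('o, 'a) arrow \<Rightarrow> ('o, 'a) arrow" (infixr "\<odot>\<^sub>a" 85) where
  "c \<odot>\<^sub>a a = Arrow (deg a) (src a) (tgt a) (c \<odot> cell a)"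

definition null :: "int \<Rightarrow> 'o \<Rightarrow> 'o \<Rightarrow> ('o, 'a) arrow" where
  "null i U V = Arrow i U V 0"

definition unit :: "'o \<Rightarrow> ('o, 'a) arrow" where
  "unit U = Arrow 0 U U (\<one> U)"

definition swap :: "'o \<Rightarrow> 'o \<Rightarrow> ('o, 'a) arrow" where
  "swap U V = Arrow 0 (U \<star> V) (V \<star> U) (\<gamma> U V)"

lemmas arrow_defs = acomp_def atens_def aplus_def aminus_def ascale_def null_def unit_def swap_def

lemma arrow_sel [simp]:
  "deg (a \<bullet> b) = deg a + deg b" "src (a \<bullet> b) = src b" "tgt (a \<bullet> b) = tgt a"
  "deg (a \<otimes>\<^sub>a b) = deg a + deg b" "src (a \<otimes>\<^sub>a b) = src a \<star> src b"
  "tgt (a \<otimes>\<^sub>a b) = tgt a \<star> tgt b"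
  "deg (a +\<^sub>a b) = deg a" "src (a +\<^sub>a b) = src a" "tgt (a +\<^sub>a b) = tgt a"
  "deg (a -\<^sub>a b) = deg a" "src (a -\<^sub>a b) = src a" "tgt (a -\<^sub>a b) = tgt a"
  "deg (c \<odot>\<^sub>a a) = deg a" "src (c \<odot>\<^sub>a a) = src a" "tgt (c \<odot>\<^sub>a a) = tgt a"
  "deg (null i U V) = i" "src (null i U V) = U" "tgt (null i U V) = V"
  "deg (unit U) = 0" "src (unit U) = U" "tgt (unit U) = U"
  "deg (swap U V) = 0" "src (swap U V) = U \<star> V" "tgt (swap U V) = V \<star> U"
  by (simp_all add: arrow_defs)

lemma cell_simps:
  "cell (a +\<^sub>a b) = cell a + cell b" "cell (a -\<^sub>a b) = cell a - cell b"
  "cell (c \<odot>\<^sub>a a) = c \<odot> cell a" "cell (null i U V) = 0"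
  by (simp_all add: arrow_defs)

lemma cell_comp: "cell (a \<bullet> b) = cell a \<cdot> cell b"
  and cell_tens: "cell (a \<otimes>\<^sub>a b) = cell a \<otimes> cell b"
  by (simp_all add: arrow_defs)

lemma zero_Hom [simp]: "0 \<in> Hom C i U V"
  using C.subspace_Hom module.subspace_0[OF C.module_ambient] by blast

lemma add_Hom: "f \<in> Hom C i U V \<Longrightarrow> g \<in> Hom C i U V \<Longrightarrow> f + g \<in> Hom C i U V"
  using C.subspace_Hom module.subspace_add[OF C.module_ambient] by blast

lemma diff_Hom: "f \<in> Hom C i U V \<Longrightarrow> g \<in> Hom C i U V \<Longrightarrow> f - g \<in> Hom C i U V"
  using C.subspace_Hom module.subspace_diff[OF C.module_ambient] by blast

lemma scale_Hom: "f \<in> Hom C i U V \<Longrightarrow> c \<odot> f \<in> Hom C i U V"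
  using C.subspace_Hom module.subspace_scale[OF C.module_ambient] by blast

lemma linear_map_zero:
  assumes "linear_map_on s s' (Hom C i U V) (f :: 'a \<Rightarrow> 'b::ab_group_add)"
  shows "f 0 = 0"
proof -
  have "f (0 + 0) = f 0 + f 0"
    using assms zero_Hom unfolding linear_map_on_def by blast
  then show ?thesis by simp
qed

lemma bilinear_zero:
  assumes "bilinear_map_on s s' (Hom C i U U') (Hom C j V V') (b :: 'a \<Rightarrow> 'a \<Rightarrow> 'b::ab_group_add)"
  shows "y \<in> Hom C j V V' \<Longrightarrow> b 0 y = 0" "x \<in> Hom C i U U' \<Longrightarrow> b x 0 = 0"
  using assms linear_map_zero unfolding bilinear_map_on_def by blast+

lemma bilinear_add:
  assumes "bilinear_map_on s s' S T b"
  shows "x \<in> S \<Longrightarrow> x' \<in> S \<Longrightarrow> y \<in> T \<Longrightarrow> b (x + x') y = b x y + b x' y"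
    and "x \<in> S \<Longrightarrow> y \<in> T \<Longrightarrow> y' \<in> T \<Longrightarrow> b x (y + y') = b x y + b x y'"
  using assms unfolding bilinear_map_on_def linear_map_on_def by blast+

lemma bilinear_scale:
  assumes "bilinear_map_on s s' S T b"
  shows "x \<in> S \<Longrightarrow> y \<in> T \<Longrightarrow> b (s c x) y = s' c (b x y)"
    and "x \<in> S \<Longrightarrow> y \<in> T \<Longrightarrow> b x (s c y) = s' c (b x y)"
  using assms unfolding bilinear_map_on_def linear_map_on_def by blast+

lemma gamma_Hom: "\<gamma> U V \<in> Hom C 0 (U \<star> V) (V \<star> U)"
  using pseudonatural2.ob_Hom[OF Sym_natural, of U V] by (simp add: natural_trans_def)

lemma wt_simps [simp]:
  "wt a \<Longrightarrow> wt b \<Longrightarrow> src a = tgt b \<Longrightarrow> wt (a \<bullet> b)"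
  "wt a \<Longrightarrow> wt b \<Longrightarrow> wt (a \<otimes>\<^sub>a b)"
  "wt a \<Longrightarrow> wt b \<Longrightarrow> deg a = deg b \<Longrightarrow> src a = src b \<Longrightarrow> tgt a = tgt b \<Longrightarrow> wt (a +\<^sub>a b)"
  "wt a \<Longrightarrow> wt b \<Longrightarrow> deg a = deg b \<Longrightarrow> src a = src b \<Longrightarrow> tgt a = tgt b \<Longrightarrow> wt (a -\<^sub>a b)"
  "wt a \<Longrightarrow> wt (c \<odot>\<^sub>a a)"
  "wt (null i U V)"
  by (simp_all add: wt_def arrow_defs C.Comp_Hom Fc_Hom add_Hom diff_Hom scale_Hom)

lemma wt_unit [simp]: "wt (unit U)"
  by (simp add: wt_def arrow_defs C.Id_Hom)

lemma wt_swap [simp]: "wt (swap U V)"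
  by (simp add: wt_def arrow_defs gamma_Hom)

declare Obt_assoc [simp]

section \<open>Linear and monoidal laws for typed cells\<close>

lemma acomp_assoc [simp]:
  "wt a \<Longrightarrow> wt b \<Longrightarrow> wt c \<Longrightarrow> src a = tgt b \<Longrightarrow> src b = tgt c \<Longrightarrow> (a \<bullet> b) \<bullet> c = a \<bullet> b \<bullet> c"
  by (simp add: wt_def acomp_def C.Comp_assoc)

lemma unit_comp [simp]: "wt a \<Longrightarrow> tgt a = U \<Longrightarrow> unit U \<bullet> a = a"
  and comp_unit [simp]: "wt a \<Longrightarrow> src a = U \<Longrightarrow> a \<bullet> unit U = a"
  by (auto simp: wt_def acomp_def unit_def C.Id_left C.Id_right intro: arrow.expand)

lemma atens_assoc [simp]: "wt a \<Longrightarrow> wt b \<Longrightarrow> wt c \<Longrightarrow> (a \<otimes>\<^sub>a b) \<otimes>\<^sub>a c = a \<otimes>\<^sub>a b \<otimes>\<^sub>a c"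
  by (simp add: wt_def atens_def Tens_assoc Obt_assoc)

lemma unit_tens_unit [simp]: "unit U \<otimes>\<^sub>a unit V = unit (U \<star> V)"
  by (simp add: arrow_defs Fc_Id)

lemma unit_tens_unit_tens [simp]: "wt a \<Longrightarrow> unit U \<otimes>\<^sub>a unit V \<otimes>\<^sub>a a = unit (U \<star> V) \<otimes>\<^sub>a a"
  by (metis atens_assoc unit_tens_unit wt_unit)

lemma interchange:
  "wt a \<Longrightarrow> wt b \<Longrightarrow> wt a' \<Longrightarrow> wt b' \<Longrightarrow> src a' = tgt a \<Longrightarrow> src b' = tgt b \<Longrightarrow>
    (a' \<otimes>\<^sub>a b') \<bullet> (a \<otimes>\<^sub>a b) = (a' \<bullet> a) \<otimes>\<^sub>a (b' \<bullet> b)"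
  by (simp add: wt_def acomp_def atens_def Fc_Comp algebra_simps)

lemma unit_tens_comp [simp]:
  "wt a \<Longrightarrow> wt b \<Longrightarrow> src a = tgt b \<Longrightarrow> unit U \<otimes>\<^sub>a (a \<bullet> b) = (unit U \<otimes>\<^sub>a a) \<bullet> (unit U \<otimes>\<^sub>a b)"
  by (simp add: interchange)

lemma comp_tens_unit [simp]:
  "wt a \<Longrightarrow> wt b \<Longrightarrow> src a = tgt b \<Longrightarrow> (a \<bullet> b) \<otimes>\<^sub>a unit U = (a \<otimes>\<^sub>a unit U) \<bullet> (b \<otimes>\<^sub>a unit U)"
  by (simp add: interchange)

lemma distribs [simp]:
  assumes "wt a" "wt b" "wt c"
  shows "src a = tgt b \<Longrightarrow> src a = tgt c \<Longrightarrow> src b = src c \<Longrightarrow> deg b = deg c \<Longrightarrow>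
      a \<bullet> (b +\<^sub>a c) = (a \<bullet> b) +\<^sub>a (a \<bullet> c)"
    and "src b = tgt a \<Longrightarrow> src c = tgt a \<Longrightarrow> tgt b = tgt c \<Longrightarrow> deg b = deg c \<Longrightarrow>
      (b +\<^sub>a c) \<bullet> a = (b \<bullet> a) +\<^sub>a (c \<bullet> a)"
    and "src b = src c \<Longrightarrow> tgt b = tgt c \<Longrightarrow> deg b = deg c \<Longrightarrow> a \<otimes>\<^sub>a (b +\<^sub>a c) = (a \<otimes>\<^sub>a b) +\<^sub>a (a \<otimes>\<^sub>a c)"
    and "src b = src c \<Longrightarrow> tgt b = tgt c \<Longrightarrow> deg b = deg c \<Longrightarrow> (b +\<^sub>a c) \<otimes>\<^sub>a a = (b \<otimes>\<^sub>a a) +\<^sub>a (c \<otimes>\<^sub>a a)"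
  using assms bilinear_add[OF C.Comp_bilinear] bilinear_add[OF Fc_bilinear]
  unfolding wt_def acomp_def atens_def aplus_def by (auto; metis)+

lemma scale_out [simp]:
  assumes "wt a" "wt b"
  shows "src a = tgt b \<Longrightarrow> a \<bullet> (c \<odot>\<^sub>a b) = c \<odot>\<^sub>a (a \<bullet> b)"
    and "src a = tgt b \<Longrightarrow> (c \<odot>\<^sub>a a) \<bullet> b = c \<odot>\<^sub>a (a \<bullet> b)"
    and "a \<otimes>\<^sub>a (c \<odot>\<^sub>a b) = c \<odot>\<^sub>a (a \<otimes>\<^sub>a b)"
    and "(c \<odot>\<^sub>a a) \<otimes>\<^sub>a b = c \<odot>\<^sub>a (a \<otimes>\<^sub>a b)"
  using assms bilinear_scale[OF C.Comp_bilinear] bilinear_scale[OF Fc_bilinear]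
  unfolding wt_def acomp_def atens_def ascale_def by (auto; metis)+

lemma null_absorb [simp]:
  assumes "wt a"
  shows "src a = V \<Longrightarrow> a \<bullet> null i U V = null (deg a + i) U (tgt a)"
    and "tgt a = U \<Longrightarrow> null i U V \<bullet> a = null (i + deg a) (src a) V"
    and "a \<otimes>\<^sub>a null i U V = null (deg a + i) (src a \<star> U) (tgt a \<star> V)"
    and "null i U V \<otimes>\<^sub>a a = null (i + deg a) (U \<star> src a) (V \<star> tgt a)"
  using assms bilinear_zero[OF C.Comp_bilinear] bilinear_zero[OF Fc_bilinear]
  unfolding wt_def acomp_def atens_def null_def by (auto; metis)+

lemma aplus_null [simp]:
  "a +\<^sub>a null i U V = a"
  "deg a = i \<Longrightarrow> src a = U \<Longrightarrow> tgt a = V \<Longrightarrow> null i U V +\<^sub>a a = a"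
  by (auto simp: aplus_def null_def intro: arrow.expand)

lemma aplus_commute: "deg a = deg b \<Longrightarrow> src a = src b \<Longrightarrow> tgt a = tgt b \<Longrightarrow> a +\<^sub>a b = b +\<^sub>a a"
  by (simp add: aplus_def add.commute)

lemma ascale_null [simp]: "c \<odot>\<^sub>a null i U V = null i U V"
  and aminus_null [simp]: "a -\<^sub>a null i U V = a"
  by (auto simp: ascale_def aminus_def null_def module.scale_zero_right[OF C.module_ambient]
      intro: arrow.expand)

section \<open>The symmetry\<close>

lemma Bd_zero: "\<partial> 0 = 0"
  using linear_map_zero[OF C.Bd_linear] .

text \<open>
  The homotopy components of \<open>\<gamma>\<close> are zero, so its three pseudonaturality equations say that it
  commutes with the pure tensors of total degree 0 and -1.
\<close>

lemma swap_natural: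
  assumes "wt a" "wt b" "(deg a, deg b) \<in> {(0, 0), (-1, 0), (0, -1)}"
  shows "swap (tgt a) (tgt b) \<bullet> (a \<otimes>\<^sub>a b) = (b \<otimes>\<^sub>a a) \<bullet> swap (src a) (src b)"
  using assms pseudonatural2.natural_1[OF Sym_natural, of "cell a" "src a" "tgt a" "cell b" "src b" "tgt b"]
    pseudonatural2.natural_2_left[OF Sym_natural, of "cell a" "src a" "tgt a" "cell b" "src b" "tgt b"]
    pseudonatural2.natural_2_right[OF Sym_natural, of "cell a" "src a" "tgt a" "cell b" "src b" "tgt b"]
  by (auto simp: wt_def arrow_defs natural_trans_def Bd_zero)

lemma swap_invol [simp]: "swap V U \<bullet> swap U V = unit (U \<star> V)"
  by (simp add: arrow_defs Sym_invol)

lemma swap_right: "swap U (V \<star> W) = (unit V \<otimes>\<^sub>a swap U W) \<bullet> (swap U V \<otimes>\<^sub>a unit W)"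
  by (simp add: arrow_defs Sym_hexagon)

lemma cancel_inverse:
  assumes "a \<bullet> b = unit (src b)" "wt a" "wt b" "wt c" "src a = tgt b" "src b = tgt c"
  shows "a \<bullet> b \<bullet> c = c"
  using assms by (metis acomp_assoc unit_comp)

lemma swap_invol_whiskered [simp]:
  "(unit W \<otimes>\<^sub>a swap V U) \<bullet> (unit W \<otimes>\<^sub>a swap U V) = unit (W \<star> U \<star> V)"
  "(swap V U \<otimes>\<^sub>a unit X) \<bullet> (swap U V \<otimes>\<^sub>a unit X) = unit (U \<star> V \<star> X)"
  "(unit W \<otimes>\<^sub>a swap V U \<otimes>\<^sub>a unit X) \<bullet> (unit W \<otimes>\<^sub>a swap U V \<otimes>\<^sub>a unit X) = unit (W \<star> U \<star> V \<star> X)"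
  by (simp_all add: interchange)

lemma swap_cancel [simp]:
  assumes "wt a"
  shows "tgt a = U \<star> V \<Longrightarrow> swap V U \<bullet> swap U V \<bullet> a = a"
    and "tgt a = W \<star> U \<star> V \<Longrightarrow> (unit W \<otimes>\<^sub>a swap V U) \<bullet> (unit W \<otimes>\<^sub>a swap U V) \<bullet> a = a"
    and "tgt a = U \<star> V \<star> X \<Longrightarrow> (swap V U \<otimes>\<^sub>a unit X) \<bullet> (swap U V \<otimes>\<^sub>a unit X) \<bullet> a = a"
    and "tgt a = W \<star> U \<star> V \<star> X \<Longrightarrow>
      (unit W \<otimes>\<^sub>a swap V U \<otimes>\<^sub>a unit X) \<bullet> (unit W \<otimes>\<^sub>a swap U V \<otimes>\<^sub>a unit X) \<bullet> a = a"
  using assms by (auto intro!: cancel_inverse)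

text \<open>Both sides are inverse to \<open>swap W (U \<star> V)\<close>, the right-hand side by \<open>swap_right\<close>.\<close>

lemma swap_left: "swap (U \<star> V) W = (swap U W \<otimes>\<^sub>a unit V) \<bullet> (unit U \<otimes>\<^sub>a swap V W)"
proof -
  let ?e = "(swap U W \<otimes>\<^sub>a unit V) \<bullet> (unit U \<otimes>\<^sub>a swap V W)"
  have "swap W (U \<star> V) \<bullet> ?e = unit (U \<star> V \<star> W)"
    by (simp add: swap_right)
  then have "swap (U \<star> V) W \<bullet> swap W (U \<star> V) \<bullet> ?e = swap (U \<star> V) W"
    by simp
  then show ?thesis
    by simp
qed

section \<open>Cells on three of four strands\<close>

text \<open>
  For an endomorphism a of UVX, \<open>skip3\<close> is its action on the first, second and fourth factor of
  UVWX; for an endomorphism a of UWX, \<open>skip2\<close> is its action on the first, third and fourth factor.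
  The idle strand is moved out of the way and back: in \<open>skip3\<close> to the far right, in \<open>skip2\<close>
  to the far left.
\<close>

definition skip3 :: "'o \<Rightarrow> 'o \<Rightarrow> 'o \<Rightarrow> 'o \<Rightarrow> ('o, 'a) arrow \<Rightarrow> ('o, 'a) arrow" where
  "skip3 U V W X a =
     (unit (U \<star> V) \<otimes>\<^sub>a swap X W) \<bullet> (a \<otimes>\<^sub>a unit W) \<bullet> (unit (U \<star> V) \<otimes>\<^sub>a swap W X)"

definition skip2 :: "'o \<Rightarrow> 'o \<Rightarrow> 'o \<Rightarrow> 'o \<Rightarrow> ('o, 'a) arrow \<Rightarrow> ('o, 'a) arrow" where
  "skip2 U V W X a =
     (swap V U \<otimes>\<^sub>a unit (W \<star> X)) \<bullet> (unit V \<otimes>\<^sub>a a) \<bullet> (swap U V \<otimes>\<^sub>a unit (W \<star> X))"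

text \<open>
  The idle strand may as well be moved to the other side, because by naturality it can be pulled
  across a. This is the form in which strictness of t produces the action on these strands when
  the third argument is split.
\<close>

lemma skip3_alt:
  assumes "wt a" "deg a \<in> {0, -1}" "src a = U \<star> V \<star> X" "tgt a = U \<star> V \<star> X"
  shows "skip3 U V W X a =
    (swap W (U \<star> V) \<otimes>\<^sub>a unit X) \<bullet> (unit W \<otimes>\<^sub>a a) \<bullet> (swap (U \<star> V) W \<otimes>\<^sub>a unit X)"
proof -
  have nat: "swap W (U \<star> V \<star> X) \<bullet> (unit W \<otimes>\<^sub>a a) = (a \<otimes>\<^sub>a unit W) \<bullet> swap W (U \<star> V \<star> X)"
    using swap_natural[of "unit W" a] assms by auto
  have hex: "swap W (U \<star> V \<star> X) = (unit (U \<star> V) \<otimes>\<^sub>a swap W X) \<bullet> (swap W (U \<star> V) \<otimes>\<^sub>a unit X)"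
    using swap_right[of W "U \<star> V" X] by simp
  have "(unit (U \<star> V) \<otimes>\<^sub>a swap X W) \<bullet> swap W (U \<star> V \<star> X) = swap W (U \<star> V) \<otimes>\<^sub>a unit X"
    by (simp add: hex)
  then have "(swap W (U \<star> V) \<otimes>\<^sub>a unit X) \<bullet> (unit W \<otimes>\<^sub>a a) \<bullet> (swap (U \<star> V) W \<otimes>\<^sub>a unit X) =
     ((unit (U \<star> V) \<otimes>\<^sub>a swap X W) \<bullet> swap W (U \<star> V \<star> X)) \<bullet> (unit W \<otimes>\<^sub>a a) \<bullet> (swap (U \<star> V) W \<otimes>\<^sub>a unit X)"
    by simp
  also have "\<dots> = (unit (U \<star> V) \<otimes>\<^sub>a swap X W) \<bullet> (swap W (U \<star> V \<star> X) \<bullet> (unit W \<otimes>\<^sub>a a)) \<bullet> (swap (U \<star> V) W \<otimes>\<^sub>a unit X)"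
    using assms by simp
  also have "\<dots> = (unit (U \<star> V) \<otimes>\<^sub>a swap X W) \<bullet> (a \<otimes>\<^sub>a unit W) \<bullet> swap W (U \<star> V \<star> X) \<bullet> (swap (U \<star> V) W \<otimes>\<^sub>a unit X)"
    unfolding nat using assms by simp
  also have "\<dots> = skip3 U V W X a"
    using assms by (simp add: hex skip3_def)
  finally show ?thesis ..
qed

lemma skip2_alt:
  assumes "wt a" "deg a \<in> {0, -1}" "src a = U \<star> W \<star> X" "tgt a = U \<star> W \<star> X"
  shows "skip2 U V W X a =
    (unit U \<otimes>\<^sub>a swap (W \<star> X) V) \<bullet> (a \<otimes>\<^sub>a unit V) \<bullet> (unit U \<otimes>\<^sub>a swap V (W \<star> X))"
proof -
  have nat: "swap (U \<star> W \<star> X) V \<bullet> (a \<otimes>\<^sub>a unit V) = (unit V \<otimes>\<^sub>a a) \<bullet> swap (U \<star> W \<star> X) V"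
    using swap_natural[of a "unit V"] assms by auto
  have hex: "swap (U \<star> W \<star> X) V = (swap U V \<otimes>\<^sub>a unit (W \<star> X)) \<bullet> (unit U \<otimes>\<^sub>a swap (W \<star> X) V)"
    using swap_left[of U "W \<star> X" V] by simp
  have "(swap V U \<otimes>\<^sub>a unit (W \<star> X)) \<bullet> swap (U \<star> W \<star> X) V = unit U \<otimes>\<^sub>a swap (W \<star> X) V"
    by (simp add: hex)
  then have "(unit U \<otimes>\<^sub>a swap (W \<star> X) V) \<bullet> (a \<otimes>\<^sub>a unit V) \<bullet> (unit U \<otimes>\<^sub>a swap V (W \<star> X)) =
     ((swap V U \<otimes>\<^sub>a unit (W \<star> X)) \<bullet> swap (U \<star> W \<star> X) V) \<bullet> (a \<otimes>\<^sub>a unit V) \<bullet> (unit U \<otimes>\<^sub>a swap V (W \<star> X))"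
    by simp
  also have "\<dots> = (swap V U \<otimes>\<^sub>a unit (W \<star> X)) \<bullet> (swap (U \<star> W \<star> X) V \<bullet> (a \<otimes>\<^sub>a unit V)) \<bullet> (unit U \<otimes>\<^sub>a swap V (W \<star> X))"
    using assms by simp
  also have "\<dots> = (swap V U \<otimes>\<^sub>a unit (W \<star> X)) \<bullet> (unit V \<otimes>\<^sub>a a) \<bullet> swap (U \<star> W \<star> X) V \<bullet> (unit U \<otimes>\<^sub>a swap V (W \<star> X))"
    unfolding nat using assms by simp
  also have "\<dots> = skip2 U V W X a"
    using assms by (simp add: hex skip2_def)
  finally show ?thesis ..
qed

section \<open>Triadditive families and the three axioms\<close>

text \<open>
  The property of the relationators on which the axioms rest: inserting a tensor product into an
  argument splits the cell into the sum of its actions on the strands that result.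
\<close>

definition triadditive :: "('o \<Rightarrow> 'o \<Rightarrow> 'o \<Rightarrow> ('o, 'a) arrow) \<Rightarrow> bool" where
  "triadditive T \<longleftrightarrow> (\<forall>U V W X.
     wt (T U V W) \<and> deg (T U V W) = -1 \<and> src (T U V W) = U \<star> V \<star> W \<and> tgt (T U V W) = U \<star> V \<star> W \<and>
     T (U \<star> V) W X = (unit U \<otimes>\<^sub>a T V W X) +\<^sub>a skip2 U V W X (T U W X) \<and>
     T U (V \<star> W) X = skip3 U V W X (T U V X) +\<^sub>a skip2 U V W X (T U W X) \<and>
     T U V (W \<star> X) = (T U V W \<otimes>\<^sub>a unit X) +\<^sub>a skip3 U V W X (T U V X))"

lemma triadditive_simps:
  assumes "triadditive T"
  shows "wt (T U V W)" "deg (T U V W) = -1" "src (T U V W) = U \<star> V \<star> W" "tgt (T U V W) = U \<star> V \<star> W"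
    "T (U \<star> V) W X = (unit U \<otimes>\<^sub>a T V W X) +\<^sub>a skip2 U V W X (T U W X)"
    "T U (V \<star> W) X = skip3 U V W X (T U V X) +\<^sub>a skip2 U V W X (T U W X)"
    "T U V (W \<star> X) = (T U V W \<otimes>\<^sub>a unit X) +\<^sub>a skip3 U V W X (T U V X)"
  using assms unfolding triadditive_def by blast+

lemma triadditive_plus:
  assumes "triadditive S" "triadditive T"
  shows "triadditive (\<lambda>U V W. S U V W +\<^sub>a T U V W)"
  unfolding triadditive_def
  by (intro allI conjI arrow.expand; 
      simp add: triadditive_simps[OF assms(1)] triadditive_simps[OF assms(2)]
        skip2_def skip3_def cell_simps algebra_simps)

lemma triadditive_scale:
  assumes "triadditive T"
  shows "triadditive (\<lambda>U V W. c \<odot>\<^sub>a T U V W)"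
  unfolding triadditive_def
  by (intro allI conjI arrow.expand;
      simp add: triadditive_simps[OF assms(1)] skip2_def skip3_def cell_simps
        module.scale_right_distrib[OF C.module_ambient])

text \<open>
  Composed with the inverse of the symmetry on the left, the summands become the actions of T on
  strands (123), (124) and (134), and the two occurrences of (134) cancel.
\<close>

lemma triadditive_left_tetrahedron:
  assumes "triadditive T"
  shows "cell (swap U (V \<star> W \<star> X) \<bullet> T U V (W \<star> X)) =
    cell ((swap U (V \<star> W \<star> X) \<bullet> T U (V \<star> W) X) +\<^sub>a
      ((unit (V \<star> W) \<otimes>\<^sub>a swap U X) \<bullet> ((swap U (V \<star> W) \<bullet> T U V W) \<otimes>\<^sub>a unit X)) -\<^sub>a
      ((unit V \<otimes>\<^sub>a (swap U (W \<star> X) \<bullet> T U W X)) \<bullet> (swap U V \<otimes>\<^sub>a unit (W \<star> X))))"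
  by (simp add: triadditive_simps[OF assms] skip2_def skip3_def cell_simps swap_right)

text \<open>The mirror image: the actions on strands (124), (134) and (234), where (124) cancels.\<close>

lemma triadditive_right_tetrahedron:
  assumes "triadditive T"
  shows "cell (swap (U \<star> V \<star> W) X \<bullet> T (U \<star> V) W X) =
    cell ((swap (U \<star> V \<star> W) X \<bullet> T U (V \<star> W) X) +\<^sub>a
      ((swap U X \<otimes>\<^sub>a unit (V \<star> W)) \<bullet> (unit U \<otimes>\<^sub>a (swap (V \<star> W) X \<bullet> T V W X))) -\<^sub>a
      (((swap (U \<star> V) X \<bullet> T U V X) \<otimes>\<^sub>a unit W) \<bullet> (unit (U \<star> V) \<otimes>\<^sub>a swap W X)))"
  by (simp add: triadditive_simps[OF assms] skip2_def skip3_def cell_simps swap_left)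

text \<open>
  The symmetry moving UV past WX has two factorisations: WX may be crossed one factor at a time,
  or the factors of UV may cross one at a time. The first one absorbs the terms with S, in which
  WX is split; the second one absorbs the terms with T, in which UV is split.
\<close>

lemma triadditive_hexahedron:
  assumes S: "triadditive S" and T: "triadditive T"
  shows "cell ((swap (U \<star> V) (W \<star> X) \<bullet> S U V (W \<star> X)) -\<^sub>a (swap (U \<star> V) (W \<star> X) \<bullet> T (U \<star> V) W X)) =
    cell (((unit W \<otimes>\<^sub>a (swap (U \<star> V) X \<bullet> S U V X)) \<bullet> (swap (U \<star> V) W \<otimes>\<^sub>a unit X)) +\<^sub>a
      ((unit W \<otimes>\<^sub>a ((swap U X \<otimes>\<^sub>a unit V) \<bullet> (unit U \<otimes>\<^sub>a swap V X))) \<bullet>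
        ((swap (U \<star> V) W \<bullet> S U V W) \<otimes>\<^sub>a unit X)) -\<^sub>a
      (((swap U (W \<star> X) \<bullet> T U W X) \<otimes>\<^sub>a unit V) \<bullet>
        (unit U \<otimes>\<^sub>a ((unit W \<otimes>\<^sub>a swap V X) \<bullet> (swap V W \<otimes>\<^sub>a unit X)))) -\<^sub>a
      ((swap U (W \<star> X) \<otimes>\<^sub>a unit V) \<bullet> (unit U \<otimes>\<^sub>a (swap V (W \<star> X) \<bullet> T V W X))))"
proof -
  note Sp = triadditive_simps[OF S] and Tp = triadditive_simps[OF T]
  have "swap (U \<star> V) (W \<star> X) \<bullet> S U V (W \<star> X) =
    ((unit W \<otimes>\<^sub>a ((swap U X \<otimes>\<^sub>a unit V) \<bullet> (unit U \<otimes>\<^sub>a swap V X))) \<bullet> ((swap (U \<star> V) W \<bullet> S U V W) \<otimes>\<^sub>a unit X)) +\<^sub>a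
    ((unit W \<otimes>\<^sub>a (swap (U \<star> V) X \<bullet> S U V X)) \<bullet> (swap (U \<star> V) W \<otimes>\<^sub>a unit X))"
    unfolding swap_left[of U V X, symmetric]
    by (simp add: Sp skip3_alt swap_right[of "U \<star> V" W X])
  moreover have "swap (U \<star> V) (W \<star> X) \<bullet> T (U \<star> V) W X =
    ((swap U (W \<star> X) \<otimes>\<^sub>a unit V) \<bullet> (unit U \<otimes>\<^sub>a (swap V (W \<star> X) \<bullet> T V W X))) +\<^sub>a
    (((swap U (W \<star> X) \<bullet> T U W X) \<otimes>\<^sub>a unit V) \<bullet>
        (unit U \<otimes>\<^sub>a ((unit W \<otimes>\<^sub>a swap V X) \<bullet> (swap V W \<otimes>\<^sub>a unit X))))"
    unfolding swap_right[of V W X, symmetric]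
    by (simp add: Tp skip2_alt swap_left[of U V "W \<star> X"])
  ultimately show ?thesis
    by (simp add: cell_simps)
qed

end

section \<open>The four-term relationators are triadditive\<close>

locale totally_symmetric_strict_inf_2_braiding =
  sym_strict_mon_ch_category C + strict_inf_2_braiding C t + totally_symmetric_inf_2_braiding C t
  for C :: "('o, 'r::comm_ring_1, 'a::ab_group_add, 'm) sym_mon_cat_scheme" (structure)
    and t :: "('o \<times> 'o, 'a \<times> 'a, 'a) trans"
begin

lemma pseudonatural: "pseudonatural2 C C (Obt C) (Tens C) (Obt C) (Tens C) t"
  using strict_inf_2_braiding_axioms by (simp add: strict_inf_2_braiding_def inf_2_braiding_def)

definition t_ob :: "'o \<Rightarrow> 'o \<Rightarrow> ('o, 'a) arrow" where
  "t_ob U V = Arrow 0 (U \<star> V) (U \<star> V) (ob t (U, V))"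

definition t_hty :: "('o, 'a) arrow \<Rightarrow> ('o, 'a) arrow \<Rightarrow> ('o, 'a) arrow" where
  "t_hty a b = Arrow (-1) (src a \<star> src b) (tgt a \<star> tgt b)
     (hty t (src a, src b) (tgt a, tgt b) (cell a, cell b))"

lemma t_ob_t_hty_sel [simp]:
  "deg (t_ob U V) = 0" "src (t_ob U V) = U \<star> V" "tgt (t_ob U V) = U \<star> V"
  "deg (t_hty a b) = -1" "src (t_hty a b) = src a \<star> src b" "tgt (t_hty a b) = tgt a \<star> tgt b"
  by (simp_all add: t_ob_def t_hty_def)

lemma cell_t_hty: "cell (t_hty a b) = hty t (src a, src b) (tgt a, tgt b) (cell a, cell b)"
  by (simp add: t_hty_def)

lemma wt_t_ob_t_hty [simp]: "wt (t_ob U V)" "wt a \<Longrightarrow> wt b \<Longrightarrow> deg a = 0 \<Longrightarrow> deg b = 0 \<Longrightarrow> wt (t_hty a b)"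
  by (simp_all add: wt_def t_ob_def t_hty_def pseudonatural2.ob_Hom[OF pseudonatural]
      pseudonatural2.hty_Hom[OF pseudonatural])

lemma t_hty_unit_unit [simp]: "t_hty (unit U) (unit V) = null (-1) (U \<star> V) (U \<star> V)"
  by (simp add: t_hty_def arrow_defs pseudonatural2.hty_Id[OF pseudonatural])

lemma t_hty_plus [simp]:
  assumes "wt a" "wt b" "wt c" "deg a = 0" "deg b = 0" "deg c = 0" "src b = src c" "tgt b = tgt c"
  shows "t_hty (b +\<^sub>a c) a = t_hty b a +\<^sub>a t_hty c a" "t_hty a (b +\<^sub>a c) = t_hty a b +\<^sub>a t_hty a c"
  using assms bilinear_add[OF pseudonatural2.hty_bilinear[OF pseudonatural]]
  by (simp_all add: t_hty_def aplus_def wt_def)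

lemma t_hty_comp:
  assumes "wt a" "wt b" "wt a'" "wt b'" "deg a = 0" "deg b = 0" "deg a' = 0" "deg b' = 0"
    "src a' = tgt a" "src b' = tgt b"
  shows "t_hty (a' \<bullet> a) (b' \<bullet> b) = (t_hty a' b' \<bullet> (a \<otimes>\<^sub>a b)) +\<^sub>a ((a' \<otimes>\<^sub>a b') \<bullet> t_hty a b)"
  using assms by (simp add: wt_def t_hty_def arrow_defs pseudonatural2.hty_Comp[OF pseudonatural])

lemma t_hty_comp_unit [simp]:
  assumes "wt a" "wt a'" "deg a = 0" "deg a' = 0" "src a' = tgt a"
  shows "t_hty (a' \<bullet> a) (unit U) = (t_hty a' (unit U) \<bullet> (a \<otimes>\<^sub>a unit U)) +\<^sub>a ((a' \<otimes>\<^sub>a unit U) \<bullet> t_hty a (unit U))"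
    and "t_hty (unit U) (a' \<bullet> a) = (t_hty (unit U) a' \<bullet> (unit U \<otimes>\<^sub>a a)) +\<^sub>a ((unit U \<otimes>\<^sub>a a') \<bullet> t_hty (unit U) a)"
  using t_hty_comp[of a "unit U" a' "unit U"] t_hty_comp[of "unit U" a "unit U" a'] assms by simp_all

text \<open>
  The first equation is total symmetry. Conjugating it with the symmetry, under which t is
  invariant, exchanges the two arguments.
\<close>

lemma t_hty_swap [simp]:
  shows "t_hty (swap U V) (unit W) = null (-1) (U \<star> V \<star> W) (V \<star> U \<star> W)"
    and "t_hty (unit W) (swap U V) = null (-1) (W \<star> U \<star> V) (W \<star> V \<star> U)"
proof -
  show *: "t_hty (swap U V) (unit W) = null (-1) (U \<star> V \<star> W) (V \<star> U \<star> W)"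
    by (simp add: arrow_defs t_hty_def totally_symmetric)
  have "swap W (V \<star> U) \<bullet> t_hty (unit W) (swap U V) = t_hty (swap U V) (unit W) \<bullet> swap W (U \<star> V)"
    by (simp add: arrow_defs t_hty_def symmetric_hty C.Id_Hom gamma_Hom)
  also have "\<dots> = null (-1) (W \<star> U \<star> V) (V \<star> U \<star> W)"
    by (simp add: *)
  finally have "swap (V \<star> U) W \<bullet> swap W (V \<star> U) \<bullet> t_hty (unit W) (swap U V) = null (-1) (W \<star> U \<star> V) (W \<star> V \<star> U)"
    by simp
  then show "t_hty (unit W) (swap U V) = null (-1) (W \<star> U \<star> V) (W \<star> V \<star> U)"
    by simp
qed

lemma t_ob_right: "t_ob U (V \<star> W) = (t_ob U V \<otimes>\<^sub>a unit W) +\<^sub>a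
    ((swap V U \<otimes>\<^sub>a unit W) \<bullet> (unit V \<otimes>\<^sub>a t_ob U W) \<bullet> (swap U V \<otimes>\<^sub>a unit W))"
  by (simp add: arrow_defs t_ob_def strict_ob_right)

lemma t_ob_left: "t_ob (U \<star> V) W = (unit U \<otimes>\<^sub>a t_ob V W) +\<^sub>a
    ((unit U \<otimes>\<^sub>a swap W V) \<bullet> (t_ob U W \<otimes>\<^sub>a unit V) \<bullet> (unit U \<otimes>\<^sub>a swap V W))"
  by (simp add: arrow_defs t_ob_def strict_ob_left)

lemma t_hty_right:
  assumes "wt a" "wt b" "wt c" "deg a = 0" "deg b = 0" "deg c = 0"
  shows "t_hty a (b \<otimes>\<^sub>a c) = (t_hty a b \<otimes>\<^sub>a c) +\<^sub>a
    ((swap (tgt b) (tgt a) \<otimes>\<^sub>a unit (tgt c)) \<bullet> (b \<otimes>\<^sub>a t_hty a c) \<bullet> (swap (src a) (src b) \<otimes>\<^sub>a unit (src c)))"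
  using assms by (simp add: wt_def arrow_defs t_hty_def strict_hty_right)

lemma t_hty_left:
  assumes "wt a" "wt b" "wt c" "deg a = 0" "deg b = 0" "deg c = 0"
  shows "t_hty (a \<otimes>\<^sub>a b) c = (a \<otimes>\<^sub>a t_hty b c) +\<^sub>a
    ((unit (tgt a) \<otimes>\<^sub>a swap (tgt c) (tgt b)) \<bullet> (t_hty a c \<otimes>\<^sub>a b) \<bullet> (unit (src a) \<otimes>\<^sub>a swap (src b) (src c)))"
  using assms by (simp add: wt_def arrow_defs t_hty_def strict_hty_left)

definition rel_L :: "'o \<Rightarrow> 'o \<Rightarrow> 'o \<Rightarrow> ('o, 'a) arrow" where
  "rel_L U V W = t_hty (t_ob U V) (unit W)"

definition rel_R :: "'o \<Rightarrow> 'o \<Rightarrow> 'o \<Rightarrow> ('o, 'a) arrow" where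
  "rel_R U V W = t_hty (unit U) (t_ob V W)"

lemma rel_typed [simp]:
  "deg (rel_L U V W) = -1" "src (rel_L U V W) = U \<star> V \<star> W" "tgt (rel_L U V W) = U \<star> V \<star> W"
  "wt (rel_L U V W)"
  "deg (rel_R U V W) = -1" "src (rel_R U V W) = U \<star> V \<star> W" "tgt (rel_R U V W) = U \<star> V \<star> W"
  "wt (rel_R U V W)"
  by (simp_all add: rel_L_def rel_R_def)

text \<open>
  Splitting W is strictness of the homotopy components at \<open>t\<^sub>U\<^sub>V \<boxtimes> (1\<^sub>W \<otimes> 1\<^sub>X)\<close>. Splitting U or V
  expands the object component of t by strictness into two terms, of which one is conjugated by
  \<open>\<gamma>\<close>; as the homotopy components of t vanish at \<open>\<gamma>\<close> and at identities, only the value at the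
  object component in the middle survives, conjugated by \<open>\<gamma>\<close>.
\<close>

lemma triadditive_rel_L: "triadditive rel_L"
proof -
  have 1: "rel_L U V (W \<star> X) = (rel_L U V W \<otimes>\<^sub>a unit X) +\<^sub>a skip3 U V W X (rel_L U V X)" for U V W X
    using t_hty_right[of "t_ob U V" "unit W" "unit X"] by (simp add: rel_L_def skip3_alt)
  have 2: "rel_L U (V \<star> W) X = skip3 U V W X (rel_L U V X) +\<^sub>a skip2 U V W X (rel_L U W X)" for U V W X
    by (simp add: rel_L_def t_ob_right t_hty_left skip3_def skip2_def)
  have 3: "rel_L (U \<star> V) W X = (unit U \<otimes>\<^sub>a rel_L V W X) +\<^sub>a skip2 U V W X (rel_L U W X)" for U V W X
    by (simp add: rel_L_def t_ob_left t_hty_left skip2_alt swap_right[of V W X] swap_left[of W X V])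
  show ?thesis
    unfolding triadditive_def using 1 2 3 by (simp add: rel_L_def)
qed

lemma triadditive_rel_R: "triadditive rel_R"
proof -
  have 1: "rel_R U V (W \<star> X) = (rel_R U V W \<otimes>\<^sub>a unit X) +\<^sub>a skip3 U V W X (rel_R U V X)" for U V W X
    by (simp add: rel_R_def t_ob_right t_hty_right skip3_alt swap_right[of W U V] swap_left[of U V W])
  have 2: "rel_R U (V \<star> W) X = skip3 U V W X (rel_R U V X) +\<^sub>a skip2 U V W X (rel_R U W X)" for U V W X
    by (subst aplus_commute) (simp_all add: rel_R_def t_ob_left t_hty_right skip3_def skip2_def)
  have 3: "rel_R (U \<star> V) W X = (unit U \<otimes>\<^sub>a rel_R V W X) +\<^sub>a skip2 U V W X (rel_R U W X)" for U V W X
    using t_hty_left[of "unit U" "unit V" "t_ob W X"] by (simp add: rel_R_def skip2_alt)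
  show ?thesis
    unfolding triadditive_def using 1 2 3 by (simp add: rel_R_def)
qed

end

section \<open>Leading terms in h\<close>

text \<open>
  The coefficients of x lie in S and x = a h^k + O(h^(k+1)). For k > 2 this means that x = 0,
  whatever a is; orders thus simply add up under products.
\<close>

definition lead :: "'a::zero set \<Rightarrow> 'a trunc \<Rightarrow> nat \<Rightarrow> 'a \<Rightarrow> bool" where
  "lead S x k a \<longleftrightarrow> co0 x \<in> S \<and> co1 x \<in> S \<and> co2 x \<in> S \<and>
     (k = 0 \<longrightarrow> co0 x = a) \<and> (k = 1 \<longrightarrow> co0 x = 0 \<and> co1 x = a) \<and>
     (k = 2 \<longrightarrow> co0 x = 0 \<and> co1 x = 0 \<and> co2 x = a) \<and>
     (k > 2 \<longrightarrow> co0 x = 0 \<and> co1 x = 0 \<and> co2 x = 0)"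

lemma lead_ext2:
  fixes b :: "'a::zero \<Rightarrow> 'b::zero \<Rightarrow> 'c::ab_group_add"
  assumes x: "lead S x j u" and y: "lead T y k v"
    and b: "\<And>f g. f \<in> S \<Longrightarrow> g \<in> T \<Longrightarrow> b f g \<in> R"
    and b0: "\<And>g. g \<in> T \<Longrightarrow> b 0 g = 0" "\<And>f. f \<in> S \<Longrightarrow> b f 0 = 0"
    and R: "0 \<in> R" "\<And>f g. f \<in> R \<Longrightarrow> g \<in> R \<Longrightarrow> f + g \<in> R"
  shows "lead R (ext2 b x y) (j + k) (b u v)"
proof -
  consider "j = 0" | "j = 1" | "j = 2" | "j > 2" by linarith
  then show ?thesis
  proof cases
    case 1
    consider "k = 0" | "k = 1" | "k = 2" | "k > 2" by linarith
    then show ?thesis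
      using x y 1 b R by cases (auto simp: lead_def ext2_def b0)
  next
    case 2
    consider "k = 0" | "k = 1" | "k = 2" | "k > 2" by linarith
    then show ?thesis
      using x y 2 b R by cases (auto simp: lead_def ext2_def b0)
  next
    case 3
    then show ?thesis
      using x y b R by (cases "k = 0") (auto simp: lead_def ext2_def b0)
  next
    case 4
    then show ?thesis
      using x y b R by (auto simp: lead_def ext2_def b0)
  qed
qed

locale deformation = totally_symmetric_strict_inf_2_braiding C t
  for C :: "('o, 'k::field, 'a::ab_group_add) sym_mon_cat" (structure)
    and t :: "('o \<times> 'o, 'a \<times> 'a, 'a) trans"
begin

definition leading :: "'a trunc \<Rightarrow> nat \<Rightarrow> ('o, 'a) arrow \<Rightarrow> bool" where
  "leading x k a \<longleftrightarrow> wt a \<and> lead (Hom C (deg a) (src a) (tgt a)) x k (cell a)"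

text \<open>
  The rules below follow the syntax of an expression over K[h]/(h^3) and produce its leading term
  as an expression over K. Orders and ends are matched by separate equations, since those of the
  factors are known only after the factors have been treated.
\<close>

lemma leading_comp:
  assumes "leading x j a" "leading y k b" "src a = tgt b" "l = j + k"
  shows "leading (ext2 (Comp C) x y) l (a \<bullet> b)"
  using assms unfolding leading_def
  by (auto simp: cell_comp intro!: lead_ext2 C.Comp_Hom add_Hom bilinear_zero[OF C.Comp_bilinear])

lemma leading_tens:
  assumes "leading x j a" "leading y k b" "l = j + k"
  shows "leading (ext2 (Tens C) x y) l (a \<otimes>\<^sub>a b)"
  using assms unfolding leading_def
  by (auto simp: cell_tens intro!: lead_ext2 Fc_Hom add_Hom bilinear_zero[OF Fc_bilinear])

lemma leading_scale:
  assumes "lead UNIV s j c" "leading x k a" "l = j + k"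
  shows "leading (ext2 (Smult C) s x) l (c \<odot>\<^sub>a a)"
  using assms unfolding leading_def
  by (auto simp: cell_simps intro!: lead_ext2 scale_Hom add_Hom
      module.scale_zero_left[OF C.module_ambient] module.scale_zero_right[OF C.module_ambient])

lemma leading_t_hty:
  assumes "leading x j a" "leading y k b" "deg a = 0" "deg b = 0"
    "U = src a" "V = src b" "U' = tgt a" "V' = tgt b" "l = j + k"
  shows "leading (ext2 (\<lambda>x y. hty t (U, V) (U', V') (x, y)) x y) l (t_hty a b)"
  using assms unfolding leading_def
  by (auto simp: cell_t_hty intro!: add_Hom pseudonatural2.hty_Hom[OF pseudonatural]
      lead_ext2[where b = "\<lambda>x y. hty t (src a, src b) (tgt a, tgt b) (x, y)"]
      bilinear_zero[OF pseudonatural2.hty_bilinear[OF pseudonatural]])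

lemma leading_plus:
  assumes "leading x k a" "leading y k b" "deg a = deg b" "src a = src b" "tgt a = tgt b"
  shows "leading (x + y) k (a +\<^sub>a b)"
  using assms unfolding leading_def lead_def by (auto simp: plus_trunc_def add_Hom cell_simps)

lemma leading_minus:
  assumes "leading x k a" "leading y k b" "deg a = deg b" "src a = src b" "tgt a = tgt b"
  shows "leading (x - y) k (a -\<^sub>a b)"
  using assms unfolding leading_def lead_def by (auto simp: minus_trunc_def diff_Hom cell_simps)

lemma leading_plus_higher:
  assumes "leading x j a" "leading y k b" "j < k" "deg a = deg b" "src a = src b" "tgt a = tgt b"
  shows "leading (x + y) j a"
  using assms unfolding leading_def lead_def
  by (auto simp: plus_trunc_def add_Hom less_Suc_eq numeral_2_eq_2)

lemma leading_null: "leading 0 k (null i U V)"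
  by (simp add: leading_def lead_def zero_trunc_def cell_simps)

lemma leading_vanish:
  assumes "leading x k a" "k > 2"
  shows "x = 0"
  using assms unfolding leading_def lead_def by (cases x) (auto simp: zero_trunc_def)

lemma leading_cst: "wt a \<Longrightarrow> leading (cst (cell a)) 0 a"
  by (simp add: leading_def lead_def cst_def wt_def)

lemma leading_unit: "leading (cst (\<one> U)) 0 (unit U)"
  using leading_cst[OF wt_unit, of U] by (simp add: unit_def)

lemma leading_swap: "leading (cst (\<gamma> U V)) 0 (swap U V)"
  using leading_cst[OF wt_swap, of U V] by (simp add: swap_def)

lemma leading_t_ob: "leading (cst (ob t (U, V))) 0 (t_ob U V)"
  using leading_cst[OF wt_t_ob_t_hty(1), of U V] by (simp add: t_ob_def)

lemma leading_eqI:
  assumes "leading x 2 a" "leading y 2 b" "cell a = cell b"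
  shows "x = y"
  using assms unfolding leading_def lead_def by (cases x; cases y) auto

section \<open>Leading terms of the deformed data\<close>

abbreviation D where "D \<equiv> deformed_data C t"

lemmas deformed_data_defs = deformed_data_def braided_data_of_def base_change_def base_change_trans_def
  add_trans_def diff_trans_def scale_trans_def commutator_trans_def vcomp_trans_def natural_trans_def
  id_trans_def trans_12_def trans_23_def exp_half_trans_def

lemma D_simps:
  "Comp D = ext2 (Comp C)" "Tens D = ext2 (Tens C)" "Obt D = Obt C" "Id D = (\<lambda>U. cst (\<one> U))"
  by (simp_all add: deformed_data_defs)

lemma D_Hom: "x \<in> Hom D i U V \<longleftrightarrow> co0 x \<in> Hom C i U V \<and> co1 x \<in> Hom C i U V \<and> co2 x \<in> Hom C i U V"
  by (cases x) (simp add: deformed_data_defs)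

lemma scalars:
  "lead UNIV (cst (1/24) * hh ^ 2 :: 'k trunc) 2 (1/24)" "lead UNIV (cst (1/2) * hh :: 'k trunc) 1 (1/2)"
  "lead UNIV (cst (1/8) * hh ^ 2 :: 'k trunc) 2 (1/8)" "lead UNIV (2 :: 'k trunc) 0 2"
proof -
  have "lead UNIV (cst 1 + cst 1 :: 'k trunc) 0 2"
    by (simp add: lead_def cst_def plus_trunc_def)
  then show "lead UNIV (2 :: 'k trunc) 0 2"
    by (metis one_add_one one_trunc_def)
qed (simp_all add: lead_def cst_def hh_def times_trunc_def ext2_def power2_eq_square)

text \<open>
  The associator, its inverse and identities are of this form. The absence of a term in h is what
  makes the homotopy components of \<open>\<sigma>\<close> vanish at these cells.
\<close>

definition near_unit :: "'a trunc \<Rightarrow> 'o \<Rightarrow> bool" where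
  "near_unit x A \<longleftrightarrow> (\<exists>c \<in> Hom C 0 A A. x = Tr (\<one> A) 0 c)"

lemma leading_near_unit: "near_unit x A \<Longrightarrow> leading x 0 (unit A)"
  by (auto simp: near_unit_def leading_def lead_def unit_def wt_def C.Id_Hom)

lemma near_unit_plus: "leading x 2 a \<Longrightarrow> deg a = 0 \<Longrightarrow> src a = A \<Longrightarrow> tgt a = A \<Longrightarrow> near_unit (cst (\<one> A) + x) A"
  by (cases x) (auto simp: near_unit_def leading_def lead_def cst_def plus_trunc_def)

text \<open>
  The inverse of 1 + c h^2 is 1 - c h^2. It is unique because comparing the coefficients of
  g x = 1 determines those of g one after the other.
\<close>

lemma near_unit_inverse:
  assumes "near_unit x A"
  shows "near_unit (inv_cell D A A x) A"
proof -
  obtain c where c: "c \<in> Hom C 0 A A" and x: "x = Tr (\<one> A) 0 c"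
    using assms by (auto simp: near_unit_def)
  have mc: "- c \<in> Hom C 0 A A"
    using diff_Hom[OF zero_Hom c] by simp
  note laws = C.Id_left C.Id_right bilinear_zero[OF C.Comp_bilinear]
  have "inv_cell D A A x = Tr (\<one> A) 0 (- c)"
    unfolding inv_cell_def
  proof (rule the_equality)
    show "Tr (\<one> A) 0 (- c) \<in> Hom D 0 A A \<and> Tr (\<one> A) 0 (- c) \<cdot>\<^bsub>D\<^esub> x = \<one>\<^bsub>D\<^esub> A \<and>
      x \<cdot>\<^bsub>D\<^esub> Tr (\<one> A) 0 (- c) = \<one>\<^bsub>D\<^esub> A"
      using c mc
      by (simp add: D_Hom D_simps x ext2_def cst_def C.Id_Hom laws[OF c] laws[OF mc]
          laws[OF C.Id_Hom] laws[OF zero_Hom[of 0 A A]])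
  next
    fix g
    assume g: "g \<in> Hom D 0 A A \<and> g \<cdot>\<^bsub>D\<^esub> x = \<one>\<^bsub>D\<^esub> A \<and> x \<cdot>\<^bsub>D\<^esub> g = \<one>\<^bsub>D\<^esub> A"
    obtain g0 g1 g2 where gs: "g = Tr g0 g1 g2" by (cases g)
    have G: "g0 \<in> Hom C 0 A A" "g1 \<in> Hom C 0 A A" "g2 \<in> Hom C 0 A A"
      using g by (simp_all add: D_Hom gs)
    have "g0 = \<one> A" "g1 = 0" "c + g2 = 0"
      using g by (auto simp: D_simps x gs ext2_def cst_def laws[OF c] laws[OF C.Id_Hom]
          laws[OF G(1)] laws[OF G(2)] laws[OF G(3)])
    then show "g = Tr (\<one> A) 0 (- c)"
      using gs by (simp add: add_eq_0_iff)
  qed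
  then show ?thesis
    using mc by (auto simp: near_unit_def)
qed

lemma leading_cong: "leading x k a \<Longrightarrow> a = b \<Longrightarrow> leading x k b"
  by simp

lemmas leading_intros = leading_comp leading_tens leading_scale leading_t_hty leading_plus leading_minus
  leading_unit leading_swap leading_t_ob scalars

lemma near_unit_assoc: "near_unit (ob (Assoc D) (U, V, W)) (U \<star> V \<star> W)"
proof -
  let ?t12 = "ext2 (Tens C) (cst (ob t (U, V))) (cst (\<one> W))"
    and ?t23 = "ext2 (Tens C) (cst (\<one> U)) (cst (ob t (V, W)))"
  have "ob (Assoc D) (U, V, W) = cst (\<one> (U \<star> V \<star> W)) + ext2 (Smult C) (cst (1/24) * hh ^ 2)
      (ext2 (Comp C) ?t12 ?t23 - ext2 (Comp C) ?t23 ?t12)"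
    by (simp add: deformed_data_defs)
  also have "near_unit \<dots> (U \<star> V \<star> W)"
    by (rule near_unit_plus, (rule leading_intros | (simp; fail))+)
  finally show ?thesis .
qed

lemma near_unit_assoc_inv:
  "near_unit (ob (inv_trans D (\<lambda>(U, V, W). U \<star> V \<star> W) (\<lambda>(U, V, W). U \<star> V \<star> W) (Assoc D)) (U, V, W))
    (U \<star> V \<star> W)"
  by (simp add: inv_trans_def near_unit_inverse near_unit_assoc)

text \<open>
  The homotopy component of the commutator of \<open>t\<^sub>1\<^sub>2\<close> and \<open>t\<^sub>2\<^sub>3\<close> is a sum of four composites, each
  with one homotopy component of \<open>t\<^sub>1\<^sub>2\<close> or \<open>t\<^sub>2\<^sub>3\<close> as a factor. As the commutator is multiplied
  by h^2, only the values of these at the leading terms a, b, c count.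
\<close>

lemma leading_assoc_hty:
  assumes xyz: "leading x 0 a" "leading y 0 b" "leading z 0 c"
    and deg: "deg a = 0" "deg b = 0" "deg c = 0"
    and t_hty: "t_hty a b = null (-1) (src a \<star> src b) (tgt a \<star> tgt b)"
      "t_hty b c = null (-1) (src b \<star> src c) (tgt b \<star> tgt c)"
    and uv: "u = (src a, src b, src c)" "v = (tgt a, tgt b, tgt c)"
    and UV: "U = src a \<star> src b \<star> src c" "V = tgt a \<star> tgt b \<star> tgt c"
  shows "leading (hty (Assoc D) u v (x, y, z)) 2 (null (-1) U V)"
proof -
  have w: "wt a" "wt b" "wt c"
    using assms by (auto simp: leading_def)
  let ?t12 = "\<lambda>u v w. ext2 (Tens C) (cst (ob t (u, v))) (cst (\<one> w))"
    and ?t23 = "\<lambda>u v w. ext2 (Tens C) (cst (\<one> u)) (cst (ob t (v, w)))"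
    and ?h12 = "ext2 (Tens C) (ext2 (\<lambda>x y. hty t (src a, src b) (tgt a, tgt b) (x, y)) x y) z"
    and ?h23 = "ext2 (Tens C) x (ext2 (\<lambda>x y. hty t (src b, src c) (tgt b, tgt c) (x, y)) y z)"
  have "hty (Assoc D) u v (x, y, z) = ext2 (Smult C) (cst (1/24) * hh ^ 2)
    ((ext2 (Comp C) ?h12 (?t23 (src a) (src b) (src c)) + ext2 (Comp C) (?t12 (tgt a) (tgt b) (tgt c)) ?h23)
     - (ext2 (Comp C) ?h23 (?t12 (src a) (src b) (src c)) + ext2 (Comp C) (?t23 (tgt a) (tgt b) (tgt c)) ?h12))"
    by (simp add: deformed_data_defs uv)
  also have "leading \<dots> 2 (null (-1) U V)"
    by (rule leading_cong, (rule leading_intros xyz | (simp add: deg; fail))+, simp add: t_hty deg w UV)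
  finally show ?thesis .
qed

lemma leading_assoc: "leading (ob (Assoc D) (U, V, W)) 0 (unit (U \<star> V \<star> W))"
  by (rule leading_near_unit near_unit_assoc)+

abbreviation assoc_inv where
  "assoc_inv \<equiv> inv_trans D (\<lambda>(U, V, W). U \<star> V \<star> W) (\<lambda>(U, V, W). U \<star> V \<star> W) (Assoc D)"

lemma leading_assoc_inv: "leading (ob assoc_inv (U, V, W)) 0 (unit (U \<star> V \<star> W))"
  by (rule leading_near_unit near_unit_assoc_inv)+

lemma leading_uminus_null: "leading x k (null i U V) \<Longrightarrow> leading (- x) k (null i U V)"
  using leading_minus[OF leading_null, of x k "null i U V"] by (simp add: aminus_def null_def)

lemma leading_assoc_inv_hty:
  assumes xyz: "leading x 0 a" "leading y 0 b" "leading z 0 c"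
    and deg: "deg a = 0" "deg b = 0" "deg c = 0"
    and t_hty: "t_hty a b = null (-1) (src a \<star> src b) (tgt a \<star> tgt b)"
      "t_hty b c = null (-1) (src b \<star> src c) (tgt b \<star> tgt c)"
    and uv: "u = (src a, src b, src c)" "v = (tgt a, tgt b, tgt c)"
    and UV: "U = src a \<star> src b \<star> src c" "V = tgt a \<star> tgt b \<star> tgt c"
  shows "leading (hty assoc_inv u v (x, y, z)) 2 (null (-1) U V)"
proof -
  have "hty assoc_inv u v (x, y, z) =
    - ext2 (Comp C) (ob assoc_inv v) (ext2 (Comp C) (hty (Assoc D) u v (x, y, z)) (ob assoc_inv u))"
    by (simp add: inv_trans_def D_simps)
  also have "leading \<dots> 2 (null (-1) U V)"
    unfolding uv
    by (rule leading_cong, rule leading_uminus_null, rule leading_cong,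
      (rule leading_intros leading_assoc_inv leading_assoc_hty assms | (simp add: UV; fail))+)
  finally show ?thesis .
qed

lemma leading_exp: "leading (cst (\<one> (U \<star> V)) + ext2 (Smult C) (cst (1/2) * hh) (cst (ob t (U, V)))
    + ext2 (Smult C) (cst (1/8) * hh ^ 2) (ext2 (Comp C) (cst (ob t (U, V))) (cst (ob t (U, V))))) 0
    (unit (U \<star> V))"
  by (rule leading_comp leading_scale leading_plus_higher leading_unit leading_t_ob scalars | (simp; fail))+

lemma leading_braid: "leading (ob (Braid D) (U, V)) 0 (swap U V)"
proof -
  have "ob (Braid D) (U, V) = ext2 (Comp C) (cst (\<gamma> U V))
    (cst (\<one> (U \<star> V)) + ext2 (Smult C) (cst (1/2) * hh) (cst (ob t (U, V)))
    + ext2 (Smult C) (cst (1/8) * hh ^ 2) (ext2 (Comp C) (cst (ob t (U, V))) (cst (ob t (U, V)))))"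
    by (simp add: deformed_data_defs)
  also have "leading \<dots> 0 (swap U V)"
    by (rule leading_cong, (rule leading_comp leading_exp leading_swap | (simp; fail))+)
  finally show ?thesis .
qed

text \<open>
  The homotopy component of t at (1 + c h^2, 1 + d h^2) has no terms in h^0 and h^1, because the
  one at identities is zero; every term of \<open>\<sigma>\<close> that contributes a homotopy component contains
  a further factor h.
\<close>

lemma braid_hty_near_unit:
  assumes "near_unit x U" "near_unit y V"
  shows "hty (Braid D) (U, V) (U, V) (x, y) = 0"
proof -
  let ?t = "cst (ob t (U, V))"
  let ?h = "ext2 (\<lambda>x y. hty t (U, V) (U, V) (x, y)) x y"
  let ?exp = "cst (\<one> (U \<star> V)) + ext2 (Smult C) (cst (1/2) * hh) ?t
    + ext2 (Smult C) (cst (1/8) * hh ^ 2) (ext2 (Comp C) ?t ?t)"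
  obtain c d where c: "c \<in> Hom C 0 U U" "x = Tr (\<one> U) 0 c" and d: "d \<in> Hom C 0 V V" "y = Tr (\<one> V) 0 d"
    using assms by (auto simp: near_unit_def)
  note hty_zero = bilinear_zero[OF pseudonatural2.hty_bilinear[OF pseudonatural]]
  define z where "z = hty t (U, V) (U, V) (\<one> U, d) + hty t (U, V) (U, V) (c, \<one> V)"
  define a where "a = Arrow (-1) (U \<star> V) (U \<star> V) z"
  have z: "z \<in> Hom C (-1) (U \<star> V) (U \<star> V)"
    unfolding z_def using c d by (intro add_Hom pseudonatural2.hty_Hom[OF pseudonatural] C.Id_Hom)
  have "?h = Tr 0 0 z"
    using c d by (simp add: ext2_def z_def hty_zero[OF C.Id_Hom] hty_zero[OF zero_Hom[of 0]]
        pseudonatural2.hty_Id[OF pseudonatural])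
  with z have h: "leading ?h 2 a"
    by (simp add: leading_def lead_def a_def wt_def)
  have a: "deg a = -1" "src a = U \<star> V" "tgt a = U \<star> V" "wt a"
    using z by (simp_all add: a_def wt_def)
  have "ext2 (Smult C) (cst (1/2) * hh) ?h = 0"
    by (rule leading_vanish, rule leading_scale[OF scalars(2) h refl], simp)
  moreover have "ext2 (Smult C) (cst (1/8) * hh ^ 2) (ext2 (Comp C) ?h ?t + ext2 (Comp C) ?t ?h) = 0"
    by (rule leading_vanish, (rule h leading_intros | (simp add: a; fail))+)
  moreover have "ext2 (Comp C) 0 ?exp = 0"
    by (rule leading_vanish, rule leading_comp[OF leading_null[of 3 0] leading_exp], simp+)
  moreover have "ext2 (Comp C) (cst (\<gamma> U V)) 0 = 0"
    by (rule leading_vanish, rule leading_comp[OF leading_swap leading_null[of 3 0]], simp+)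
  moreover have "hty (Braid D) (U, V) (U, V) (x, y) = ext2 (Comp C) 0 ?exp + ext2 (Comp C) (cst (\<gamma> U V))
      (ext2 (Smult C) (cst (1/2) * hh) ?h
       + ext2 (Smult C) (cst (1/8) * hh ^ 2) (ext2 (Comp C) ?h ?t + ext2 (Comp C) ?t ?h))"
    by (simp add: deformed_data_defs)
  ultimately show ?thesis
    by simp
qed

lemma leading_braid_hty:
  assumes "near_unit x U" "near_unit y V" "A = U \<star> V" "B = V \<star> U"
  shows "leading (hty (Braid D) (U, V) (U, V) (x, y)) 2 (null (-1) A B)"
  using braid_hty_near_unit[OF assms(1,2)] leading_null by simp

lemma near_unit_unit: "near_unit (cst (\<one> U)) U"
  by (auto simp: near_unit_def cst_def)

lemma leading_HexL: "leading (HexL D U V W) 2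
    (swap U (V \<star> W) \<bullet> (1/24) \<odot>\<^sub>a (2 \<odot>\<^sub>a rel_L U V W +\<^sub>a rel_R U V W))"
proof -
  have "HexL D U V W = ext2 (Smult C) (cst (1/24) * hh ^ 2) (ext2 (Comp C) (cst (\<gamma> U (V \<star> W)))
     (ext2 (Smult C) 2 (ext2 (\<lambda>x y. hty t (U \<star> V, W) (U \<star> V, W) (x, y)) (cst (ob t (U, V))) (cst (\<one> W)))
      + ext2 (\<lambda>x y. hty t (U, V \<star> W) (U, V \<star> W) (x, y)) (cst (\<one> U)) (cst (ob t (V, W)))))"
    by (simp add: deformed_data_defs relator_L_def relator_R_def)
  also have "leading \<dots> 2 (swap U (V \<star> W) \<bullet> (1/24) \<odot>\<^sub>a (2 \<odot>\<^sub>a rel_L U V W +\<^sub>a rel_R U V W))"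
    by (rule leading_cong, (rule leading_intros | (simp; fail))+, simp add: rel_L_def rel_R_def)
  finally show ?thesis .
qed

lemma leading_HexR: "leading (HexR D U V W) 2
    (swap (U \<star> V) W \<bullet> (1/24) \<odot>\<^sub>a (rel_L U V W +\<^sub>a 2 \<odot>\<^sub>a rel_R U V W))"
proof -
  have "HexR D U V W = ext2 (Smult C) (cst (1/24) * hh ^ 2) (ext2 (Comp C) (cst (\<gamma> (U \<star> V) W))
     (ext2 (\<lambda>x y. hty t (U \<star> V, W) (U \<star> V, W) (x, y)) (cst (ob t (U, V))) (cst (\<one> W))
      + ext2 (Smult C) 2 (ext2 (\<lambda>x y. hty t (U, V \<star> W) (U, V \<star> W) (x, y)) (cst (\<one> U)) (cst (ob t (V, W))))))"
    by (simp add: deformed_data_defs relator_L_def relator_R_def)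
  also have "leading \<dots> 2 (swap (U \<star> V) W \<bullet> (1/24) \<odot>\<^sub>a (rel_L U V W +\<^sub>a 2 \<odot>\<^sub>a rel_R U V W))"
    by (rule leading_cong, (rule leading_intros | (simp; fail))+, simp add: rel_L_def rel_R_def)
  finally show ?thesis .
qed

section \<open>The three axioms\<close>

text \<open>
  Each side of an axiom is decomposed down to the data by these rules. This yields its leading term of
  order h^2, with units in place of the associators; the vanishing factors enter as zero cells.
\<close>

lemmas leading_data = leading_comp leading_tens leading_plus leading_minus leading_unit leading_assoc
  leading_assoc_inv leading_assoc_hty leading_assoc_inv_hty leading_braid leading_braid_hty
  leading_HexL leading_HexR near_unit_assoc near_unit_assoc_inv near_unit_unit

lemma triadditive_hexL: "triadditive (\<lambda>U V W. (1/24) \<odot>\<^sub>a (2 \<odot>\<^sub>a rel_L U V W +\<^sub>a rel_R U V W))"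
  by (intro triadditive_scale triadditive_plus triadditive_rel_L triadditive_rel_R)

lemma triadditive_hexR: "triadditive (\<lambda>U V W. (1/24) \<odot>\<^sub>a (rel_L U V W +\<^sub>a 2 \<odot>\<^sub>a rel_R U V W))"
  by (intro triadditive_scale triadditive_plus triadditive_rel_L triadditive_rel_R)

lemma left_tetrahedron: "left_tetrahedron D"
  unfolding left_tetrahedron_def D_simps
  apply (intro allI)
  subgoal for U V W X
    apply (rule leading_eqI, (rule leading_data | (simp; fail))+)
    using triadditive_left_tetrahedron[OF triadditive_hexL, of U V W X]
    by (simp add: cell_simps)
  done

lemma right_tetrahedron: "right_tetrahedron D"
  unfolding right_tetrahedron_def D_simps
  apply (intro allI)
  subgoal for U V W X
    apply (rule leading_eqI, (rule leading_data | (simp; fail))+)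
    using triadditive_right_tetrahedron[OF triadditive_hexR, of U V W X]
    by (simp add: cell_simps)
  done

lemma hexahedron: "hexahedron D"
  unfolding hexahedron_def D_simps
  apply (intro allI)
  subgoal for U V W X
    apply (rule leading_eqI, (rule leading_data | (simp; fail))+)
    using triadditive_hexahedron[OF triadditive_hexR triadditive_hexL, of U V W X]
    by (simp add: cell_simps)
  done

end

theorem proposition5p25:
  fixes C :: "('o, 'k::field_char_0, 'a::ab_group_add) sym_mon_cat"
    and t :: "('o \<times> 'o, 'a \<times> 'a, 'a) trans"
  assumes "sym_strict_mon_ch_category C"
    and "strict_inf_2_braiding C t"
    and "totally_symmetric_inf_2_braiding C t"
  shows "left_tetrahedron (deformed_data C t)
    \<and> right_tetrahedron (deformed_data C t)
    \<and> hexahedron (deformed_data C t)"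
proof -
  interpret deformation C t
    using assms by (simp add: deformation_def totally_symmetric_strict_inf_2_braiding_def)
  show ?thesis
    using left_tetrahedron right_tetrahedron hexahedron by blast
qed

end
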